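(* Let $F$ be a field of characteristic $0$. In $\mathfrak{sl}_2(F)$ put $t=e_{12}$, $v=e_{21}$, $u=e_{11}-e_{22}$, and let $B=\langle u,v\rangle_L$ be the Lie subalgebra of $\mathfrak{sl}_2(F)$ generated by $u$ and $v$. Let $L=\mathfrak{sl}_2(F)\oplus B$ with componentwise bracket $[(a,b),(c,d)]=([a,c],[b,d])$, graded by the multiplicative semigroup $(\mathbb{Z}_2,\cdot)=\{0,1\}$ via $L=L_0\oplus L_1$ with $$L_0=\{(a,0)\mid a\in\mathfrak{sl}_2(F)\},\qquad L_1=\{(a,a)\mid a\in B\}.$$ Then the limit $\lim_{n\to\infty}\sqrt[n]{c_n^{\mathbb{Z}_2}(L)}$ exists and $$\lim_{n\to\infty}\sqrt[n]{c_n^{\mathbb{Z}_2}(L)}=2+2\sqrt{2},$$ where $c_n^{\mathbb{Z}_2}(L)$ denotes the $n$-th graded codimension of $L$ with respect to this $(\mathbb{Z}_2,\cdot)$-grading.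
   Context: For a semigroup $T$ (written multiplicatively), a $T$-grading on a Lie algebra $L$ is a vector space decomposition $L=\bigoplus_{t\in T}L^{(t)}$ with $[L^{(s)},L^{(t)}]\subseteq L^{(st)}$ for all $s,t\in T$. Here $T=(\mathbb{Z}_2,\cdot)$, with $L^{(0)}=L_0$ and $L^{(1)}=L_1$. Here $e_{ij}$ are the $2\times 2$ matrix units. Graded codimensions. For a finite semigroup $T$ let $L(X^{T\text{-gr}})$ be the free Lie algebra over $F$ on the variables $x_i^{(t)}$ ($i\in\mathbb{N}$, $t\in T$). A polynomial $f\in L(X^{T\text{-gr}})$ is a graded identity of $L$ if it vanishes whenever every variable $x_i^{(t)}$ is replaced by an arbitrary element of $L^{(t)}$. Let $\mathrm{Id}^{T\text{-gr}}(L)$ be the set of all graded identities. Let $$V_n^{T\text{-gr}}=\mathrm{span}_F\{[x_{\sigma(1)}^{(t_1)},\ldots,x_{\sigma(n)}^{(t_n)}]\mid \sigma\in S_n,\ t_i\in T\},$$ with left-normed commutators $[a_1,\ldots,a_n]=[[a_1,\ldots,a_{n-1}],a_n]$. The $n$-th graded codimension is $$c_n^{T}(L)=c_n^{T\text{-gr}}(L)=\dim_F\frac{V_n^{T\text{-gr}}}{V_n^{T\text{-gr}}\cap \mathrm{Id}^{T\text{-gr}}(L)}.$$ *)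

theory Defs
  imports "HOL-Analysis.Analysis"
begin

section \<open>Dimension of a quotient space\<close>

text \<open>The prefix \<open>local\<close> keeps the names from resolving to their instances for \<open>real_vector\<close>.\<close>

context vector_space
begin

definition coset :: "'b set \<Rightarrow> 'b \<Rightarrow> 'b set" where
  "coset W v = {v + w | w. w \<in> W}"

definition coset_space :: "'b set \<Rightarrow> 'b set \<Rightarrow> 'b set set" where
  "coset_space V W = local.coset W ` V"

text \<open>The linear combination of the cosets \<open>C \<in> \<B>\<close> with coefficients \<open>c C\<close>, computed from
  arbitrary representatives \<open>r C\<close>.\<close>

definition coset_lincomb :: "'b set \<Rightarrow> 'b set set \<Rightarrow> ('b set \<Rightarrow> 'a) \<Rightarrow> 'b set" where
  "coset_lincomb W \<B> c = {w + (\<Sum>C\<in>\<B>. scale (c C) (r C)) | w r. w \<in> W \<and> (\<forall>C\<in>\<B>. r C \<in> C)}"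

definition quotient_basis :: "'b set \<Rightarrow> 'b set \<Rightarrow> 'b set set \<Rightarrow> bool" where
  "quotient_basis V W \<B> \<longleftrightarrow> finite \<B> \<and> \<B> \<subseteq> local.coset_space V W \<and>
     (\<forall>C\<in>local.coset_space V W. \<exists>!c. (\<forall>D. D \<notin> \<B> \<longrightarrow> c D = 0) \<and> C = local.coset_lincomb W \<B> c)"

text \<open>As for \<^const>\<open>dim\<close>, the value is \<open>0\<close> if there is no finite basis.\<close>

definition quotient_dim :: "'b set \<Rightarrow> 'b set \<Rightarrow> nat" where
  "quotient_dim V W =
     (if \<exists>\<B>. local.quotient_basis V W \<B> then card (SOME \<B>. local.quotient_basis V W \<B>) else 0)"

end

section \<open>Lie algebras\<close>

locale lie_algebra = vector_space scale
  for scale :: "'a::field \<Rightarrow> 'b::ab_group_add \<Rightarrow> 'b" +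
  fixes bracket :: "'b \<Rightarrow> 'b \<Rightarrow> 'b"
  assumes bracket_add_left: "bracket (x + y) z = bracket x z + bracket y z"
    and bracket_add_right: "bracket x (y + z) = bracket x y + bracket x z"
    and bracket_scale_left: "bracket (scale c x) y = scale c (bracket x y)"
    and bracket_scale_right: "bracket x (scale c y) = scale c (bracket x y)"
    and bracket_self: "bracket x x = 0"
    and jacobi: "bracket x (bracket y z) + bracket y (bracket z x) + bracket z (bracket x y) = 0"
begin

definition lie_subalgebra :: "'b set \<Rightarrow> bool" where
  "lie_subalgebra S \<longleftrightarrow> subspace S \<and> (\<forall>x\<in>S. \<forall>y\<in>S. bracket x y \<in> S)"

definition lie_generated :: "'b set \<Rightarrow> 'b set" where
  "lie_generated X = lie_subalgebra hull X"

fun left_normed :: "'b list \<Rightarrow> 'b" where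
  "left_normed [] = 0"
| "left_normed (x # xs) = foldl bracket x xs"

definition grading :: "'b set \<Rightarrow> ('t::{finite, semigroup_mult} \<Rightarrow> 'b set) \<Rightarrow> bool" where
  "grading L G \<longleftrightarrow> lie_subalgebra L \<and> (\<forall>t. subspace (G t) \<and> G t \<subseteq> L) \<and>
     (\<forall>x\<in>L. \<exists>!f. (\<forall>t. f t \<in> G t) \<and> x = (\<Sum>t\<in>UNIV. f t)) \<and>
     (\<forall>s t. \<forall>x\<in>G s. \<forall>y\<in>G t. bracket x y \<in> G (s * t))"

end

section \<open>The free Lie algebra\<close>

text \<open>Formal Lie expressions in variables from \<^typ>\<open>'x\<close>, modulo the least congruence that
  enforces the axioms of a Lie algebra over \<^typ>\<open>'a\<close>.\<close>

datatype ('a, 'x) lie_term =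
    TVar 'x
  | TZero
  | TAdd "('a, 'x) lie_term" "('a, 'x) lie_term"
  | TScale 'a "('a, 'x) lie_term"
  | TBracket "('a, 'x) lie_term" "('a, 'x) lie_term"

inductive lie_eq :: "('a::field, 'x) lie_term \<Rightarrow> ('a, 'x) lie_term \<Rightarrow> bool" where
  refl: "lie_eq p p"
| sym: "lie_eq p q \<Longrightarrow> lie_eq q p"
| trans: "lie_eq p q \<Longrightarrow> lie_eq q r \<Longrightarrow> lie_eq p r"
| cong_add: "lie_eq p p' \<Longrightarrow> lie_eq q q' \<Longrightarrow> lie_eq (TAdd p q) (TAdd p' q')"
| cong_scale: "lie_eq p p' \<Longrightarrow> lie_eq (TScale c p) (TScale c p')"
| cong_bracket: "lie_eq p p' \<Longrightarrow> lie_eq q q' \<Longrightarrow> lie_eq (TBracket p q) (TBracket p' q')"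
| add_assoc: "lie_eq (TAdd (TAdd p q) r) (TAdd p (TAdd q r))"
| add_commute: "lie_eq (TAdd p q) (TAdd q p)"
| add_zero: "lie_eq (TAdd TZero p) p"
| add_inverse: "lie_eq (TAdd (TScale (- 1) p) p) TZero"
| scale_add_right: "lie_eq (TScale c (TAdd p q)) (TAdd (TScale c p) (TScale c q))"
| scale_add_left: "lie_eq (TScale (c + d) p) (TAdd (TScale c p) (TScale d p))"
| scale_scale: "lie_eq (TScale c (TScale d p)) (TScale (c * d) p)"
| scale_one: "lie_eq (TScale 1 p) p"
| bracket_add_left: "lie_eq (TBracket (TAdd p q) r) (TAdd (TBracket p r) (TBracket q r))"
| bracket_add_right: "lie_eq (TBracket p (TAdd q r)) (TAdd (TBracket p q) (TBracket p r))"
| bracket_scale_left: "lie_eq (TBracket (TScale c p) q) (TScale c (TBracket p q))"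
| bracket_scale_right: "lie_eq (TBracket p (TScale c q)) (TScale c (TBracket p q))"
| bracket_self: "lie_eq (TBracket p p) TZero"
| jacobi: "lie_eq (TAdd (TAdd (TBracket p (TBracket q r)) (TBracket q (TBracket r p)))
     (TBracket r (TBracket p q))) TZero"

quotient_type (overloaded) ('a, 'x) free_lie = "('a::field, 'x) lie_term" / lie_eq
proof (intro equivpI reflpI sympI transpI)
  show "lie_eq p p" for p :: "('a, 'x) lie_term" by (rule lie_eq.refl)
  show "lie_eq p q \<Longrightarrow> lie_eq q p" for p q :: "('a, 'x) lie_term" by (rule lie_eq.sym)
  show "lie_eq p q \<Longrightarrow> lie_eq q r \<Longrightarrow> lie_eq p r" for p q r :: "('a, 'x) lie_term"
    by (rule lie_eq.trans)
qed

instantiation free_lie :: (field, type) ab_group_add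
begin

lift_definition zero_free_lie :: "('a, 'b) free_lie" is TZero .

lift_definition plus_free_lie :: "('a, 'b) free_lie \<Rightarrow> ('a, 'b) free_lie \<Rightarrow> ('a, 'b) free_lie"
  is TAdd by (rule lie_eq.cong_add)

lift_definition uminus_free_lie :: "('a, 'b) free_lie \<Rightarrow> ('a, 'b) free_lie"
  is "TScale (- 1)" by (rule lie_eq.cong_scale)

lift_definition minus_free_lie :: "('a, 'b) free_lie \<Rightarrow> ('a, 'b) free_lie \<Rightarrow> ('a, 'b) free_lie"
  is "\<lambda>p q. TAdd p (TScale (- 1) q)" by (intro lie_eq.cong_add lie_eq.cong_scale)

instance
proof
  fix a b c :: "('a, 'b) free_lie"
  show "a + b + c = a + (b + c)" by transfer (rule lie_eq.add_assoc)
  show "a + b = b + a" by transfer (rule lie_eq.add_commute)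
  show "0 + a = a" by transfer (rule lie_eq.add_zero)
  show "- a + a = 0" by transfer (rule lie_eq.add_inverse)
  show "a - b = a + - b" by transfer (rule lie_eq.refl)
qed

end

lift_definition free_scale :: "'a::field \<Rightarrow> ('a, 'x) free_lie \<Rightarrow> ('a, 'x) free_lie"
  is TScale by (rule lie_eq.cong_scale)

lift_definition free_bracket :: "('a::field, 'x) free_lie \<Rightarrow> ('a, 'x) free_lie \<Rightarrow> ('a, 'x) free_lie"
  is TBracket by (rule lie_eq.cong_bracket)

lift_definition free_var :: "'x \<Rightarrow> ('a::field, 'x) free_lie" is TVar .

interpretation free_lie: lie_algebra free_scale free_bracket
proof
  fix c d :: 'a and x y z :: "('a, 'x) free_lie"
  show "free_scale c (x + y) = free_scale c x + free_scale c y"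
    by transfer (rule lie_eq.scale_add_right)
  show "free_scale (c + d) x = free_scale c x + free_scale d x"
    by transfer (rule lie_eq.scale_add_left)
  show "free_scale c (free_scale d x) = free_scale (c * d) x"
    by transfer (rule lie_eq.scale_scale)
  show "free_scale 1 x = x"
    by transfer (rule lie_eq.scale_one)
  show "free_bracket (x + y) z = free_bracket x z + free_bracket y z"
    by transfer (rule lie_eq.bracket_add_left)
  show "free_bracket x (y + z) = free_bracket x y + free_bracket x z"
    by transfer (rule lie_eq.bracket_add_right)
  show "free_bracket (free_scale c x) y = free_scale c (free_bracket x y)"
    by transfer (rule lie_eq.bracket_scale_left)
  show "free_bracket x (free_scale c y) = free_scale c (free_bracket x y)"
    by transfer (rule lie_eq.bracket_scale_right)
  show "free_bracket x x = 0"
    by transfer (rule lie_eq.bracket_self)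
  show "free_bracket x (free_bracket y z) + free_bracket y (free_bracket z x)
      + free_bracket z (free_bracket x y) = 0"
    by transfer (rule lie_eq.jacobi)
qed

context lie_algebra
begin

text \<open>Substituting \<open>\<phi> x\<close> for each variable \<open>x\<close>.\<close>

primrec eval_term :: "('x \<Rightarrow> 'b) \<Rightarrow> ('a, 'x) lie_term \<Rightarrow> 'b" where
  "eval_term \<phi> (TVar x) = \<phi> x"
| "eval_term \<phi> TZero = 0"
| "eval_term \<phi> (TAdd p q) = eval_term \<phi> p + eval_term \<phi> q"
| "eval_term \<phi> (TScale c p) = scale c (eval_term \<phi> p)"
| "eval_term \<phi> (TBracket p q) = bracket (eval_term \<phi> p) (eval_term \<phi> q)"

lemma eval_term_cong: "lie_eq p q \<Longrightarrow> eval_term \<phi> p = eval_term \<phi> q"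
  by (induction rule: lie_eq.induct)
    (simp_all add: scale_right_distrib scale_left_distrib bracket_add_left bracket_add_right
      bracket_scale_left bracket_scale_right bracket_self jacobi)

lift_definition eval :: "('x \<Rightarrow> 'b) \<Rightarrow> ('a, 'x) free_lie \<Rightarrow> 'b" is eval_term
  by (rule eval_term_cong)

lemma eval_simps [simp]:
  "eval \<phi> (free_var x) = \<phi> x"
  "eval \<phi> 0 = 0"
  "eval \<phi> (f + g) = eval \<phi> f + eval \<phi> g"
  "eval \<phi> (free_scale c f) = scale c (eval \<phi> f)"
  "eval \<phi> (free_bracket f g) = bracket (eval \<phi> f) (eval \<phi> g)"
  by (transfer; simp)+

end

section \<open>Graded identities and graded codimensions\<close>

definition multilinear_part :: "nat \<Rightarrow> ('a::field, nat \<times> 't) free_lie set" where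
  "multilinear_part n = free_lie.span
     {free_lie.left_normed (map (\<lambda>i. free_var (\<sigma> i, \<tau> i)) [1..<n+1]) | \<sigma> \<tau>. \<sigma> permutes {1..n}}"

context lie_algebra
begin

definition graded_identities :: "('t \<Rightarrow> 'b set) \<Rightarrow> ('a, nat \<times> 't) free_lie set" where
  "graded_identities G = {f. \<forall>\<phi>. (\<forall>i t. \<phi> (i, t) \<in> G t) \<longrightarrow> eval \<phi> f = 0}"

definition graded_codim :: "('t \<Rightarrow> 'b set) \<Rightarrow> nat \<Rightarrow> nat" where
  "graded_codim G n = free_lie.quotient_dim
     (multilinear_part n) (multilinear_part n \<inter> graded_identities G)"

end

section \<open>The algebra \<open>\<ss>\<ll>\<^sub>2 \<oplus> B\<close>\<close>

text \<open>All Lie algebras are carried by subspaces of \<open>\<gg>\<ll>\<^sub>2\<close> and \<open>\<gg>\<ll>\<^sub>2 \<oplus> \<gg>\<ll>\<^sub>2\<close>.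
  As \<open>\<ss>\<ll>\<^sub>2\<close> is a subalgebra of \<open>\<gg>\<ll>\<^sub>2\<close>, the subalgebra generated by \<open>u\<close> and \<open>v\<close> is the same in both.\<close>

type_synonym 'a mat2 = "'a^2^2"

definition mat2_scale :: "'a::field \<Rightarrow> 'a mat2 \<Rightarrow> 'a mat2" where
  "mat2_scale c = map_matrix ((*) c)"

definition mat2_bracket :: "'a::field mat2 \<Rightarrow> 'a mat2 \<Rightarrow> 'a mat2" where
  "mat2_bracket A B = A ** B - B ** A"

definition pair_scale :: "'a::field \<Rightarrow> 'a mat2 \<times> 'a mat2 \<Rightarrow> 'a mat2 \<times> 'a mat2" where
  "pair_scale c x = (mat2_scale c (fst x), mat2_scale c (snd x))"

definition pair_bracket :: "'a::field mat2 \<times> 'a mat2 \<Rightarrow> 'a mat2 \<times> 'a mat2 \<Rightarrow> 'a mat2 \<times> 'a mat2" where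
  "pair_bracket x y = (mat2_bracket (fst x) (fst y), mat2_bracket (snd x) (snd y))"

lemma mat2_eq_iff: "(A :: 'a mat2) = B \<longleftrightarrow>
    A$1$1 = B$1$1 \<and> A$1$2 = B$1$2 \<and> A$2$1 = B$2$1 \<and> A$2$2 = B$2$2"
  by (auto simp: vec_eq_iff forall_2)

lemma mat2_scale_nth [simp]: "mat2_scale c A $ i $ j = c * A $ i $ j"
  by (simp add: mat2_scale_def map_matrix_def)

lemma mat2_bracket_nth: "mat2_bracket A B $ i $ j =
    A$i$1 * B$1$j + A$i$2 * B$2$j - (B$i$1 * A$1$j + B$i$2 * A$2$j)"
  by (simp add: mat2_bracket_def matrix_matrix_mult_def sum_2)

interpretation mat2: lie_algebra mat2_scale mat2_bracket
  by unfold_locales (auto simp: mat2_eq_iff mat2_bracket_nth algebra_simps)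

interpretation mat2_pair: lie_algebra pair_scale pair_bracket
  by unfold_locales
    (auto simp: pair_scale_def pair_bracket_def prod_eq_iff mat2.scale_right_distrib
      mat2.scale_left_distrib mat2.bracket_add_left mat2.bracket_add_right
      mat2.bracket_scale_left mat2.bracket_scale_right mat2.bracket_self mat2.jacobi)

definition matrix_unit :: "2 \<Rightarrow> 2 \<Rightarrow> 'a::field mat2" where
  "matrix_unit k l = (\<chi> i j. if i = k \<and> j = l then 1 else 0)"

definition sl2 :: "'a::field mat2 set" where
  "sl2 = {A. trace A = 0}"

definition u_elt :: "'a::field mat2" where
  "u_elt = matrix_unit 1 1 - matrix_unit 2 2"

definition v_elt :: "'a::field mat2" where
  "v_elt = matrix_unit 2 1"

definition B_alg :: "'a::field mat2 set" where
  "B_alg = mat2.lie_generated {u_elt, v_elt}"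

definition L_alg :: "('a::field mat2 \<times> 'a mat2) set" where
  "L_alg = sl2 \<times> B_alg"

text \<open>The grading semigroup is the multiplicative semigroup of the ring \<open>\<int>/2\<close>, which is the
  type \<^typ>\<open>2\<close>.\<close>

definition L_comp :: "2 \<Rightarrow> ('a::field mat2 \<times> 'a mat2) set" where
  "L_comp t = (if t = 0 then {(a, 0) | a. a \<in> sl2} else {(a, a) | a. a \<in> B_alg})"

lemma sl2_subalgebra: "mat2.lie_subalgebra sl2"
  unfolding mat2.lie_subalgebra_def mat2.subspace_def sl2_def trace_def
  by (auto simp: sum_2 mat2_bracket_nth algebra_simps simp flip: distrib_left)

lemma B_subalgebra: "mat2.lie_subalgebra B_alg"
  unfolding B_alg_def mat2.lie_generated_def
  by (rule hull_in) (auto simp: mat2.lie_subalgebra_def intro!: mat2.subspace_Inter)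

lemma B_subset_sl2: "B_alg \<subseteq> sl2"
  unfolding B_alg_def mat2.lie_generated_def
  by (rule hull_minimal)
    (auto simp: sl2_subalgebra, auto simp: sl2_def u_elt_def v_elt_def matrix_unit_def trace_def sum_2)

lemma mat2_bracket_closed: "mat2.lie_subalgebra S \<Longrightarrow> A \<in> S \<Longrightarrow> B \<in> S \<Longrightarrow> mat2_bracket A B \<in> S"
  by (simp add: mat2.lie_subalgebra_def)

lemma UNIV_Z2: "(UNIV :: 2 set) = {0, 1}"
  using UNIV_2 by auto

lemma L_grading: "mat2_pair.grading L_alg (L_comp :: 2 \<Rightarrow> ('a::field mat2 \<times> 'a mat2) set)"
proof -
  have S: "mat2.subspace (sl2 :: 'a mat2 set)" and T: "mat2.subspace (B_alg :: 'a mat2 set)"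
    using sl2_subalgebra B_subalgebra by (auto simp: mat2.lie_subalgebra_def)
  note clo = mat2.subspace_0[OF S] mat2.subspace_0[OF T] mat2.subspace_add[OF S]
    mat2.subspace_add[OF T] mat2.subspace_scale[OF S] mat2.subspace_scale[OF T]
    mat2_bracket_closed[OF sl2_subalgebra] mat2_bracket_closed[OF B_subalgebra]
  have br0 [simp]: "mat2_bracket A 0 = 0" "mat2_bracket 0 A = 0" for A :: "'a mat2"
    by (simp_all add: mat2_bracket_def)
  have "mat2_pair.lie_subalgebra (L_alg :: ('a mat2 \<times> 'a mat2) set)"
    unfolding mat2_pair.lie_subalgebra_def mat2_pair.subspace_def L_alg_def
    by (auto simp: pair_scale_def pair_bracket_def zero_prod_def clo)
  moreover have "mat2_pair.subspace (L_comp t :: ('a mat2 \<times> 'a mat2) set)" for t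
    unfolding mat2_pair.subspace_def L_comp_def
    by (auto simp: pair_scale_def zero_prod_def clo)
  moreover have "L_comp t \<subseteq> (L_alg :: ('a mat2 \<times> 'a mat2) set)" for t
    using B_subset_sl2 by (auto simp: L_comp_def L_alg_def clo)
  moreover have "\<exists>!f. (\<forall>t. f t \<in> L_comp t) \<and> x = (\<Sum>t\<in>UNIV. f t)"
    if x: "x \<in> L_alg" for x :: "'a mat2 \<times> 'a mat2"
  proof
    let ?f = "\<lambda>t::2. if t = 0 then (fst x - snd x, 0) else (snd x, snd x)"
    have "fst x - snd x \<in> sl2"
      using x B_subset_sl2 by (auto simp: L_alg_def intro!: mat2.subspace_diff[OF S])
    then show "(\<forall>t. ?f t \<in> L_comp t) \<and> x = (\<Sum>t\<in>UNIV. ?f t)"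
      using x by (auto simp: L_comp_def L_alg_def UNIV_Z2)
    fix f :: "2 \<Rightarrow> 'a mat2 \<times> 'a mat2"
    assume f: "(\<forall>t. f t \<in> L_comp t) \<and> x = (\<Sum>t\<in>UNIV. f t)"
    then have "f 0 \<in> L_comp 0" "f 1 \<in> L_comp 1" and x': "x = f 0 + f 1"
      by (auto simp: UNIV_Z2)
    then have "snd (f 0) = 0" "fst (f 1) = snd (f 1)"
      by (auto simp: L_comp_def)
    then have "f 0 = ?f 0" "f 1 = ?f 1"
      using x' by (auto simp: prod_eq_iff)
    moreover have "t = 0 \<or> t = 1" for t :: 2
      using UNIV_Z2 by auto
    ultimately show "f = ?f"
      by (metis (no_types, lifting) ext)
  qed
  moreover have "pair_bracket x y \<in> L_comp (s * t)"
    if "x \<in> L_comp s" "y \<in> L_comp t" for s t and x y :: "'a mat2 \<times> 'a mat2"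
  proof -
    have "s \<in> {0, 1}" "t \<in> {0, 1}"
      using UNIV_Z2 by auto
    then show ?thesis
      using that
      by (auto simp: L_comp_def pair_bracket_def clo subsetD[OF B_subset_sl2])
  qed
  ultimately show ?thesis
    by (simp add: mat2_pair.grading_def)
qed

end

theory Submission
  imports Defs "HOL-Combinatorics.Multiset_Permutations" "HOL-Real_Asymp.Real_Asymp"
begin

text \<open>
  A multilinear polynomial is determined modulo the graded identities by its values on words over
  the five homogeneous basis elements \<open>(t,0), (u,0), (v,0), (u,u), (v,v)\<close>. Giving \<open>t, u, v\<close> the weights
  \<open>1, 0, -1\<close>, such a value lies in a weight space of dimension at most one, which is nonzero only if
  the word has weight in \<open>{-1, 0, 1}\<close>. Since the Laurent polynomial \<open>z + 2 + 2/z\<close> that counts letters by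
  weight takes its minimum \<open>2 + 2\<surd>2\<close> on the positive reals at \<open>z = \<surd>2\<close>, there are at most
  \<open>\<surd>2 (2 + 2\<surd>2)\<^sup>n\<close> such words.

  For the lower bound, consider words of weight zero that are ballot sequences in both degrees and fill
  their positions into columns \<open>t, u, v\<close> (degree 0) and \<open>u, v\<close> (degree 1), as in a standard Young
  tableau. Alternating over each column gives a Lie polynomial. An alternating sum over a full column
  \<open>t, u, v\<close> acts as a scalar on \<open>\<ss>\<ll>\<^sub>2\<close>, and because the weights of the remaining columns are
  extremal, a word on which the polynomial does not vanish arises from the original one by permuting
  letters within columns. This makes the evaluation matrix triangular. There are enough ballot words:
  concatenate arbitrary rearrangements of a block with letter frequencies close to \<open>\<surd>2 : 1 : 1/\<surd>2 : 1 : 1/\<surd>2\<close>.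
\<close>

section \<open>Dimension of a quotient space\<close>

context vector_space
begin

lemma coset_eq_iff:
  assumes "subspace W"
  shows "local.coset W x = local.coset W y \<longleftrightarrow> x - y \<in> W"
proof
  assume "local.coset W x = local.coset W y"
  moreover have "x \<in> local.coset W x"
    using subspace_0[OF assms] by (force simp: coset_def)
  ultimately obtain w where "w \<in> W" "x = y + w"
    by (auto simp: coset_def)
  then show "x - y \<in> W" by simp
next
  assume d: "x - y \<in> W"
  have "v \<in> local.coset W x \<longleftrightarrow> v - x \<in> W" for v x
    by (force simp: coset_def)
  moreover have "v - x \<in> W \<longleftrightarrow> v - y \<in> W" for v
    using subspace_add[OF assms _ d, of "v - x"] subspace_diff[OF assms _ d, of "v - y"] by auto
  ultimately show "local.coset W x = local.coset W y" by blast
qed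

lemma mem_coset_iff: "v \<in> local.coset W x \<longleftrightarrow> v - x \<in> W"
  by (force simp: coset_def)

text \<open>Two representatives of a coset differ by an element of \<open>W\<close>, so all choices
  of representatives fill one and the same coset.\<close>

lemma coset_lincomb_eq:
  assumes W: "subspace W" and B: "\<B> \<subseteq> local.coset_space V W" and \<rho>: "\<And>C. C \<in> \<B> \<Longrightarrow> \<rho> C \<in> C"
  shows "local.coset_lincomb W \<B> c = local.coset W (\<Sum>C\<in>\<B>. scale (c C) (\<rho> C))"
proof (intro set_eqI iffI)
  fix x assume "x \<in> local.coset_lincomb W \<B> c"
  then obtain w r where x: "x = w + (\<Sum>C\<in>\<B>. scale (c C) (r C))" and w: "w \<in> W"
    and r: "\<forall>C\<in>\<B>. r C \<in> C"
    by (auto simp: coset_lincomb_def)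
  have "r C - \<rho> C \<in> W" if C: "C \<in> \<B>" for C
  proof -
    obtain a where a: "C = local.coset W a"
      using B C by (auto simp: coset_space_def)
    have "r C \<in> C" "\<rho> C \<in> C"
      using r \<rho> C by simp_all
    then have "r C - a \<in> W" "\<rho> C - a \<in> W"
      unfolding mem_coset_iff[symmetric] a by simp_all
    from subspace_diff[OF W this] show ?thesis by simp
  qed
  then have "w + (\<Sum>C\<in>\<B>. scale (c C) (r C - \<rho> C)) \<in> W"
    by (intro subspace_add[OF W w] subspace_sum[OF W] subspace_scale[OF W]) auto
  then show "x \<in> local.coset W (\<Sum>C\<in>\<B>. scale (c C) (\<rho> C))"
    by (simp add: mem_coset_iff x scale_right_diff_distrib sum_subtractf algebra_simps)
next
  fix x assume "x \<in> local.coset W (\<Sum>C\<in>\<B>. scale (c C) (\<rho> C))"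
  then show "x \<in> local.coset_lincomb W \<B> c"
    using \<rho> unfolding coset_lincomb_def mem_coset_iff
    by (intro CollectI exI[of _ "x - (\<Sum>C\<in>\<B>. scale (c C) (\<rho> C))"] exI[of _ \<rho>]) simp
qed

text \<open>Trades equality of cosets for membership in \<open>W\<close>, so that the later
  arguments can work with vectors.\<close>

lemma quotient_basis_iff:
  assumes W: "subspace W" and fin: "finite \<B>" and B: "\<B> \<subseteq> local.coset_space V W"
    and \<rho>: "\<And>C. C \<in> \<B> \<Longrightarrow> \<rho> C \<in> C"
  shows "local.quotient_basis V W \<B> \<longleftrightarrow>
    (\<forall>v\<in>V. \<exists>!c. (\<forall>D. D \<notin> \<B> \<longrightarrow> c D = 0) \<and> v - (\<Sum>C\<in>\<B>. scale (c C) (\<rho> C)) \<in> W)"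
  unfolding quotient_basis_def coset_space_def
  using fin B coset_lincomb_eq[OF W B \<rho>] by (simp add: coset_eq_iff[OF W] coset_space_def)

section \<open>Independence modulo a subspace and bounds for the dimension of a quotient\<close>

definition independent_mod :: "'b set \<Rightarrow> 'i set \<Rightarrow> ('i \<Rightarrow> 'b) \<Rightarrow> bool" where
  "independent_mod W I f \<longleftrightarrow> (\<forall>c. (\<Sum>i\<in>I. scale (c i) (f i)) \<in> W \<longrightarrow> (\<forall>i\<in>I. c i = 0))"

text \<open>Adjoining a basis of \<open>W\<close> turns independence modulo \<open>W\<close> into
  ordinary independence, to which the exchange bound applies. The indexed family \<open>f\<close> is
  forced to be injective and to avoid \<open>W\<close>, hence the cardinalities add.\<close>

lemma independent_mod_Un_basis:
  assumes I: "finite I" "local.independent_mod W I f"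
    and A: "finite A" "independent A" "span A = W"
  shows "independent (f ` I \<union> A)" "card (f ` I \<union> A) = card I + card A"
proof -
  have ind: "c i = 0" if "(\<Sum>i\<in>I. scale (c i) (f i)) \<in> W" "i \<in> I" for c i
    using I that by (auto simp: independent_mod_def)
  have "inj_on f I"
  proof
    fix i j assume ij: "i \<in> I" "j \<in> I" "f i = f j"
    show "i = j"
    proof (rule ccontr)
      assume "i \<noteq> j"
      let ?c = "\<lambda>k. (if k = i then 1 else 0) - (if k = j then 1 else 0)"
      have "(\<Sum>k\<in>I. scale (?c k) (f k)) = f i - f j"
        using I(1) ij(1,2)
        by (simp add: scale_left_diff_distrib sum_subtractf if_distrib[of "\<lambda>c. scale c _"] cong: if_cong)
      then have "(\<Sum>k\<in>I. scale (?c k) (f k)) \<in> W"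
        using ij A(3) span_zero[of A] by simp
      from ind[OF this ij(1)] \<open>i \<noteq> j\<close> show False by simp
    qed
  qed
  have "f i \<notin> A" if "i \<in> I" for i
  proof
    assume "f i \<in> A"
    then have "f i \<in> W" using A(3) span_base by auto
    moreover have "(\<Sum>k\<in>I. scale (if k = i then 1 else 0) (f k)) = f i"
      using I(1) that by (simp add: if_distrib[of "\<lambda>c. scale c _"] cong: if_cong)
    ultimately show False
      using ind[of "\<lambda>k. if k = i then 1 else 0" i] that by simp
  qed
  then have disj: "f ` I \<inter> A = {}" by auto
  show "card (f ` I \<union> A) = card I + card A"
    using disj \<open>inj_on f I\<close> I(1) A(1) by (simp add: card_Un_disjoint card_image)
  show "independent (f ` I \<union> A)"
  proof (rule independent_if_scalars_zero)
    show "finite (f ` I \<union> A)" using I A by simp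
    fix c x assume s: "(\<Sum>x\<in>f ` I \<union> A. scale (c x) x) = 0" and x: "x \<in> f ` I \<union> A"
    have s': "(\<Sum>i\<in>I. scale (c (f i)) (f i)) + (\<Sum>x\<in>A. scale (c x) x) = 0"
      using s disj I(1) A(1) by (simp add: sum.union_disjoint sum.reindex[OF \<open>inj_on f I\<close>])
    then have "(\<Sum>i\<in>I. scale (c (f i)) (f i)) = - (\<Sum>x\<in>A. scale (c x) x)"
      by (rule eq_neg_iff_add_eq_0[THEN iffD2])
    also have "\<dots> \<in> W"
      unfolding A(3)[symmetric] by (intro span_neg span_sum span_scale span_base)
    finally have z: "c (f i) = 0" if "i \<in> I" for i
      using ind[of "\<lambda>i. c (f i)"] that by auto
    then have "(\<Sum>x\<in>A. scale (c x) x) = 0"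
      using s' by simp
    then have "\<forall>x\<in>A. c x = 0"
      using A(2) independentD[OF A(2) A(1) subset_refl] by blast
    then show "c x = 0" using x z by auto
  qed
qed

lemma ex1_implies_uniq: "\<exists>!x. P x \<Longrightarrow> P a \<Longrightarrow> P b \<Longrightarrow> a = b"
  by blast

text \<open>Uniqueness of the coordinates of the zero vector is independence modulo
  \<open>W\<close>; existence of coordinates is generation modulo \<open>W\<close>.\<close>

lemma quotient_basis_representatives:
  assumes W: "subspace W" "W \<subseteq> V" and V: "subspace V" and B: "local.quotient_basis V W \<B>"
  obtains \<rho> where "\<And>C. C \<in> \<B> \<Longrightarrow> \<rho> C \<in> V" "local.independent_mod W \<B> \<rho>"
    "\<And>v. v \<in> V \<Longrightarrow> \<exists>c. v - (\<Sum>C\<in>\<B>. scale (c C) (\<rho> C)) \<in> W"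
proof -
  have fin: "finite \<B>" and BV: "\<B> \<subseteq> local.coset_space V W"
    using B by (auto simp: quotient_basis_def)
  have "\<exists>v\<in>V. v \<in> C" if "C \<in> \<B>" for C
    using BV that subspace_0[OF W(1)] by (force simp: coset_space_def mem_coset_iff)
  then obtain \<rho> where \<rho>: "\<And>C. C \<in> \<B> \<Longrightarrow> \<rho> C \<in> V" "\<And>C. C \<in> \<B> \<Longrightarrow> \<rho> C \<in> C"
    by metis
  have ex: "\<exists>!c. (\<forall>D. D \<notin> \<B> \<longrightarrow> c D = 0) \<and> v - (\<Sum>C\<in>\<B>. scale (c C) (\<rho> C)) \<in> W"
    if "v \<in> V" for v
    using B quotient_basis_iff[OF W(1) fin BV \<rho>(2)] that by blast
  have "c C = 0" if "(\<Sum>C\<in>\<B>. scale (c C) (\<rho> C)) \<in> W" "C \<in> \<B>" for c C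
  proof -
    \<comment> \<open>Uniqueness holds only among coefficient functions that vanish off
      \<open>\<B>\<close>, hence the truncation of \<open>c\<close>.\<close>
    let ?c = "\<lambda>C. if C \<in> \<B> then c C else 0"
    have "(\<Sum>C\<in>\<B>. scale (?c C) (\<rho> C)) \<in> W"
      using that(1) by (simp cong: sum.cong)
    then have 1: "(\<forall>D. D \<notin> \<B> \<longrightarrow> ?c D = 0) \<and> 0 - (\<Sum>C\<in>\<B>. scale (?c C) (\<rho> C)) \<in> W"
      using subspace_neg[OF W(1)] by simp
    have 2: "(\<forall>D. D \<notin> \<B> \<longrightarrow> (\<lambda>_. 0) D = 0) \<and> 0 - (\<Sum>C\<in>\<B>. scale ((\<lambda>_. 0) C) (\<rho> C)) \<in> W"
      using subspace_0[OF W(1)] by simp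
    have "?c = (\<lambda>_. 0)"
      by (rule ex1_implies_uniq[OF ex[OF subspace_0[OF V]], of ?c "\<lambda>_. 0"]) (rule 1, rule 2)
    from fun_cong[OF this, of C] show ?thesis using that(2) by simp
  qed
  then have "local.independent_mod W \<B> \<rho>"
    by (auto simp: independent_mod_def)
  moreover have "\<exists>c. v - (\<Sum>C\<in>\<B>. scale (c C) (\<rho> C)) \<in> W" if "v \<in> V" for v
    using ex1_implies_ex[OF ex[OF that]] by (elim exE conjE) (rule exI)
  ultimately show thesis
    using that[OF \<rho>(1)] by simp
qed

lemma finite_basis_of_subspace:
  assumes "subspace W" "W \<subseteq> span T" "finite T"
  obtains A where "finite A" "independent A" "span A = W"
proof -
  obtain A where A: "A \<subseteq> W" "independent A" "W \<subseteq> span A"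
    by (rule maximal_independent_subset)
  then have "finite A"
    using independent_span_bound[OF assms(3) A(2)] assms(2) by blast
  moreover have "span A = W"
    using A span_minimal[OF A(1) assms(1)] by blast
  ultimately show thesis using A that by blast
qed

text \<open>A basis \<open>A\<close> of \<open>W\<close> extends to a basis \<open>B\<close> of
  \<open>V\<close>, and the cosets of the vectors in \<open>B - A\<close> form a basis of the
  quotient. Without such a basis \<open>quotient_dim\<close> would be the default value 0.\<close>

lemma quotient_basis_exists:
  assumes W: "subspace W" "W \<subseteq> V" and V: "subspace V" "V \<subseteq> span T" "finite T"
  shows "\<exists>\<B>. local.quotient_basis V W \<B>"
proof -
  obtain A where A: "finite A" "independent A" "span A = W"
    using finite_basis_of_subspace[OF W(1) _ V(3)] W(2) V(2) by blast
  then have "A \<subseteq> V" using W(2) span_superset by blast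
  then obtain B where B: "A \<subseteq> B" "B \<subseteq> V" "independent B" "V \<subseteq> span B"
    using maximal_independent_subset_extend[OF _ A(2)] by metis
  have finB: "finite B"
    using independent_span_bound[OF V(3) B(3)] B(2) V(2) by blast
  define E where "E = B - A"
  have E: "finite E" "E \<subseteq> V" "B = E \<union> A" "E \<inter> A = {}"
    using finB B by (auto simp: E_def)
  have ind: "c e = 0" if s: "(\<Sum>e\<in>E. scale (c e) e) \<in> W" and e: "e \<in> E" for c e
  proof -
    obtain d where d: "(\<Sum>e\<in>E. scale (c e) e) = (\<Sum>a\<in>A. scale (d a) a)"
      using s span_finite[OF A(1)] A(3) by auto
    let ?u = "\<lambda>x. if x \<in> E then c x else - d x"
    have "(\<Sum>x\<in>E. scale (?u x) x) = (\<Sum>x\<in>E. scale (c x) x)"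
      by (rule sum.cong) auto
    moreover have "(\<Sum>x\<in>A. scale (?u x) x) = - (\<Sum>x\<in>A. scale (d x) x)"
      using E(4) unfolding sum_negf[symmetric] by (intro sum.cong) auto
    ultimately have "(\<Sum>x\<in>B. scale (?u x) x) = 0"
      using E A(1) d by (simp add: sum.union_disjoint)
    from independentD[OF B(3) finB subset_refl this, of e] e E(3) show ?thesis by auto
  qed
  have inj: "inj_on (local.coset W) E"
  proof
    fix x y assume xy: "x \<in> E" "y \<in> E" "local.coset W x = local.coset W y"
    show "x = y"
    proof (rule ccontr)
      assume "x \<noteq> y"
      let ?c = "\<lambda>k. (if k = x then 1 else 0) - (if k = y then 1 else 0)"
      have "(\<Sum>k\<in>E. scale (?c k) k) = x - y"
        using E(1) xy(1,2)
        by (simp add: scale_left_diff_distrib sum_subtractf if_distrib[of "\<lambda>c. scale c _"] cong: if_cong)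
      then have "(\<Sum>k\<in>E. scale (?c k) k) \<in> W"
        using xy coset_eq_iff[OF W(1)] by simp
      from ind[OF this xy(1)] \<open>x \<noteq> y\<close> show False by simp
    qed
  qed
  let ?\<B> = "local.coset W ` E" and ?\<rho> = "the_inv_into E (local.coset W)"
  have \<rho>: "?\<rho> (local.coset W e) = e" if "e \<in> E" for e
    using inj that by (rule the_inv_into_f_f)
  have self: "e \<in> local.coset W e" for e
    using subspace_0[OF W(1)] by (simp add: mem_coset_iff)
  have "\<exists>!c. (\<forall>D. D \<notin> ?\<B> \<longrightarrow> c D = 0) \<and> v - (\<Sum>C\<in>?\<B>. scale (c C) (?\<rho> C)) \<in> W" if v: "v \<in> V" for v
  proof -
    have sum_eq: "(\<Sum>C\<in>?\<B>. scale (c C) (?\<rho> C)) = (\<Sum>e\<in>E. scale (c (local.coset W e)) e)" for c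
      by (simp add: sum.reindex[OF inj] \<rho>)
    obtain d where d: "v = (\<Sum>b\<in>B. scale (d b) b)"
      using v B(4) span_finite[OF finB] by auto
    have "v - (\<Sum>e\<in>E. scale (d e) e) = (\<Sum>a\<in>A. scale (d a) a)"
      using E A(1) by (simp add: d sum.union_disjoint)
    also have "\<dots> \<in> W"
      unfolding A(3)[symmetric] by (intro span_sum span_scale span_base)
    finally have dW: "v - (\<Sum>e\<in>E. scale (d e) e) \<in> W" .
    let ?c = "\<lambda>C. if C \<in> ?\<B> then d (?\<rho> C) else 0"
    show ?thesis
    proof (rule ex1I[of _ ?c])
      show "(\<forall>D. D \<notin> ?\<B> \<longrightarrow> ?c D = 0) \<and> v - (\<Sum>C\<in>?\<B>. scale (?c C) (?\<rho> C)) \<in> W"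
        using dW by (simp add: sum_eq \<rho> del: if_image_distrib cong: sum.cong)
      fix c assume c: "(\<forall>D. D \<notin> ?\<B> \<longrightarrow> c D = 0) \<and> v - (\<Sum>C\<in>?\<B>. scale (c C) (?\<rho> C)) \<in> W"
      then have "v - (\<Sum>e\<in>E. scale (c (local.coset W e)) e) \<in> W" by (simp add: sum_eq)
      from subspace_diff[OF W(1) dW this]
      have "(\<Sum>e\<in>E. scale (c (local.coset W e) - d e) e) \<in> W"
        by (simp add: scale_left_diff_distrib sum_subtractf)
      then have "c (local.coset W e) = d e" if "e \<in> E" for e
        using ind[of "\<lambda>e. c (local.coset W e) - d e"] that by auto
      then show "c = ?c"
        using c by (auto simp: fun_eq_iff \<rho>)
    qed
  qed
  moreover have "?\<rho> C \<in> C" if "C \<in> ?\<B>" for C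
    using that \<rho> self by auto
  moreover have "?\<B> \<subseteq> local.coset_space V W"
    using E by (auto simp: coset_space_def)
  ultimately have "local.quotient_basis V W ?\<B>"
    using E(1) by (subst quotient_basis_iff[OF W(1), where \<rho> = ?\<rho>]) auto
  then show ?thesis ..
qed

text \<open>With a basis \<open>A\<close> of \<open>W\<close> adjoined on both sides, the exchange
  bound compares \<open>card I + card A\<close> with \<open>card \<B> + card A\<close>. This is done
  for every quotient basis, since \<open>SOME\<close> may pick any of them.\<close>

lemma quotient_dim_ge:
  assumes W: "subspace W" "W \<subseteq> V" and V: "subspace V" "V \<subseteq> span T" "finite T"
    and f: "finite I" "f ` I \<subseteq> V" "local.independent_mod W I f"
  shows "card I \<le> local.quotient_dim V W"
proof -
  obtain A where A: "finite A" "independent A" "span A = W"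
    using finite_basis_of_subspace[OF W(1) _ V(3)] W(2) V(2) by blast
  have "card I \<le> card \<B>" if \<B>: "local.quotient_basis V W \<B>" for \<B>
  proof -
    have fin: "finite \<B>" using \<B> by (simp add: quotient_basis_def)
    obtain \<rho> where \<rho>: "\<And>v. v \<in> V \<Longrightarrow> \<exists>c. v - (\<Sum>C\<in>\<B>. scale (c C) (\<rho> C)) \<in> W"
      by (rule quotient_basis_representatives[OF W V(1) \<B>]) blast
    have "V \<subseteq> span (\<rho> ` \<B> \<union> A)"
    proof
      fix v assume "v \<in> V"
      then obtain c where c: "v - (\<Sum>C\<in>\<B>. scale (c C) (\<rho> C)) \<in> W"
        using \<rho> by blast
      have "W \<subseteq> span (\<rho> ` \<B> \<union> A)"
        unfolding A(3)[symmetric] by (intro span_mono) auto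
      then have "v - (\<Sum>C\<in>\<B>. scale (c C) (\<rho> C)) \<in> span (\<rho> ` \<B> \<union> A)"
        using c by blast
      moreover have "(\<Sum>C\<in>\<B>. scale (c C) (\<rho> C)) \<in> span (\<rho> ` \<B> \<union> A)"
        by (intro span_sum span_scale span_base) auto
      ultimately show "v \<in> span (\<rho> ` \<B> \<union> A)"
        using span_add by fastforce
    qed
    moreover have "f ` I \<union> A \<subseteq> V"
      using f(2) W(2) A(3) span_superset by blast
    ultimately have "f ` I \<union> A \<subseteq> span (\<rho> ` \<B> \<union> A)" by (rule subset_trans[rotated])
    then have "card (f ` I \<union> A) \<le> card (\<rho> ` \<B> \<union> A)"
      using independent_span_bound[OF _ independent_mod_Un_basis(1)[OF f(1,3) A]] fin A(1) by simp
    also have "\<dots> \<le> card \<B> + card A"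
      using card_Un_le[of "\<rho> ` \<B>" A] card_image_le[OF fin, of \<rho>] by linarith
    finally show ?thesis
      using independent_mod_Un_basis(2)[OF f(1,3) A] by simp
  qed
  then show ?thesis
    using quotient_basis_exists[OF W V] unfolding quotient_dim_def
    by (metis (mono_tags, lifting) someI_ex)
qed

text \<open>The dual comparison: representatives of a quotient basis, together with a basis of
  \<open>W\<close>, are independent in the span of \<open>S\<close> and that basis.\<close>

lemma quotient_dim_le:
  assumes W: "subspace W" "W \<subseteq> V" and V: "subspace V" "V \<subseteq> span T" "finite T"
    and S: "finite S" "V \<subseteq> span (S \<union> W)"
  shows "local.quotient_dim V W \<le> card S"
proof -
  obtain A where A: "finite A" "independent A" "span A = W"
    using finite_basis_of_subspace[OF W(1) _ V(3)] W(2) V(2) by blast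
  have "S \<union> W \<subseteq> span (S \<union> A)"
    using A(3) span_mono[of A "S \<union> A"] span_superset[of "S \<union> A"] by blast
  then have VA: "V \<subseteq> span (S \<union> A)"
    using S(2) span_mono[of "S \<union> W" "span (S \<union> A)"] by (simp add: span_span)
  have "card \<B> \<le> card S" if \<B>: "local.quotient_basis V W \<B>" for \<B>
  proof -
    have fin: "finite \<B>" using \<B> by (simp add: quotient_basis_def)
    obtain \<rho> where \<rho>: "\<And>C. C \<in> \<B> \<Longrightarrow> \<rho> C \<in> V" "local.independent_mod W \<B> \<rho>"
      by (rule quotient_basis_representatives[OF W V(1) \<B>]) blast
    have "\<rho> ` \<B> \<union> A \<subseteq> V"
      using \<rho>(1) W(2) A(3) span_superset by blast
    then have "\<rho> ` \<B> \<union> A \<subseteq> span (S \<union> A)" using VA by (rule subset_trans)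
    then have "card (\<rho> ` \<B> \<union> A) \<le> card (S \<union> A)"
      using independent_span_bound[OF _ independent_mod_Un_basis(1)[OF fin \<rho>(2) A]] S(1) A(1) by simp
    also have "\<dots> \<le> card S + card A"
      by (rule card_Un_le)
    finally show ?thesis
      using independent_mod_Un_basis(2)[OF fin \<rho>(2) A] by simp
  qed
  then show ?thesis
    unfolding quotient_dim_def by (metis (mono_tags, lifting) someI_ex zero_le)
qed

text \<open>Passing to the kernel of one more functional costs at most one vector, namely any
  \<open>s\<close> on which it does not vanish.\<close>

lemma span_functionals:
  assumes "finite G" and "subspace V"
    and "\<And>g. g \<in> G \<Longrightarrow> module_hom scale (*) g"
  shows "\<exists>S. finite S \<and> card S \<le> card G \<and> V \<subseteq> span (S \<union> {v \<in> V. \<forall>g\<in>G. g v = 0})"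
  using assms
proof (induction G arbitrary: V rule: finite_induct)
  case empty
  then show ?case by (intro exI[of _ "{}"]) (auto intro: span_base)
next
  case (insert g G)
  interpret g: module_hom scale "(*)" g using insert.prems by simp
  let ?V = "{v \<in> V. g v = 0}"
  have "subspace ?V"
    using insert.prems(1) by (auto simp: subspace_def g.add g.scale g.zero)
  then obtain S where S: "finite S" "card S \<le> card G" "?V \<subseteq> span (S \<union> {v \<in> ?V. \<forall>g\<in>G. g v = 0})"
    using insert.IH[OF \<open>subspace ?V\<close>] insert.prems(2) by auto
  have eq: "{v \<in> ?V. \<forall>h\<in>G. h v = 0} = {v \<in> V. \<forall>h\<in>insert g G. h v = 0}" by auto
  show ?case
  proof (cases "\<exists>s\<in>V. g s \<noteq> 0")
    case False
    then have "?V = V" by auto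
    then show ?thesis
      using S insert.hyps unfolding eq by (intro exI[of _ S]) auto
  next
    case True
    then obtain s where s: "s \<in> V" "g s \<noteq> 0" by blast
    let ?X = "insert s S \<union> {v \<in> V. \<forall>h\<in>insert g G. h v = 0}"
    have sub: "?V \<subseteq> span ?X"
      using S(3) span_mono[of "S \<union> {v \<in> V. \<forall>h\<in>insert g G. h v = 0}" ?X] unfolding eq by blast
    have "V \<subseteq> span ?X"
    proof
      fix v assume v: "v \<in> V"
      let ?a = "g v / g s"
      have "v - scale ?a s \<in> ?V"
        using v s subspace_diff[OF insert.prems(1) v subspace_scale[OF insert.prems(1) s(1)]]
        by (simp add: g.diff g.scale)
      moreover have "scale ?a s \<in> span ?X"
        by (intro span_scale span_base) auto
      ultimately show "v \<in> span ?X"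
        using sub span_add[of "v - scale ?a s" ?X "scale ?a s"] by auto
    qed
    moreover have "card (insert s S) \<le> card (insert g G)"
      using S insert.hyps card_insert_le_m1[of "Suc (card G)" S s] by simp
    ultimately show ?thesis
      using S(1) by (intro exI[of _ "insert s S"]) auto
  qed
qed

end

section \<open>Evaluation on words\<close>

text \<open>The digit is the degree of the basis element for which the letter stands.\<close>

datatype letter = T0 | U0 | V0 | U1 | V1

lemma UNIV_letter: "UNIV = {T0, U0, V0, U1, V1}"
  by (auto intro: letter.exhaust)

instance letter :: finite
  by standard (simp add: UNIV_letter)

fun letter_type :: "letter \<Rightarrow> 2" where
  "letter_type T0 = 0" | "letter_type U0 = 0" | "letter_type V0 = 0"
| "letter_type U1 = 1" | "letter_type V1 = 1"

text \<open>Half the eigenvalue under the adjoint action of \<open>u_elt\<close>.\<close>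

fun weight :: "letter \<Rightarrow> int" where
  "weight T0 = 1" | "weight U0 = 0" | "weight V0 = -1" | "weight U1 = 0" | "weight V1 = -1"

definition t_elt :: "'a::field mat2" where
  "t_elt = matrix_unit 1 2"

fun letter_mat :: "letter \<Rightarrow> 'a::field mat2" where
  "letter_mat T0 = t_elt" | "letter_mat U0 = u_elt" | "letter_mat V0 = v_elt"
| "letter_mat U1 = u_elt" | "letter_mat V1 = v_elt"

lemmas elt_defs = t_elt_def u_elt_def v_elt_def matrix_unit_def

definition letter_val :: "letter \<Rightarrow> 'a::field mat2 \<times> 'a mat2" where
  "letter_val a = (letter_mat a, if letter_type a = 0 then 0 else letter_mat a)"

text \<open>Index \<open>i\<close> belongs to position \<open>i - 1\<close> of the word. A variable
  whose degree differs from that of its letter gets 0, which lies in every component; so the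
  substitution is admissible, and a monomial can be nonzero only if its degrees are those of the
  word.\<close>

definition word_subst :: "letter list \<Rightarrow> nat \<times> 2 \<Rightarrow> 'a::field mat2 \<times> 'a mat2" where
  "word_subst w = (\<lambda>(i, t). if 1 \<le> i \<and> i \<le> length w \<and> letter_type (w ! (i - 1)) = t
     then letter_val (w ! (i - 1)) else 0)"

lemma Z2_cases: obtains "(t::2) = 0" | "t = 1"
  using UNIV_Z2 by auto

lemma B_alg_generators: "u_elt \<in> B_alg" "v_elt \<in> B_alg"
  unfolding B_alg_def mat2.lie_generated_def by (simp_all add: hull_inc)

text \<open>The lower triangular matrices of trace zero form a subalgebra that contains
  \<open>u_elt\<close> and \<open>v_elt\<close>.\<close>

lemma B_alg_entries:
  assumes "A \<in> B_alg"
  shows "A $ 1 $ 2 = 0" "A $ 2 $ 2 = - A $ 1 $ 1"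
proof -
  let ?S = "{A :: 'a mat2. A $ 1 $ 2 = 0 \<and> A $ 2 $ 2 = - A $ 1 $ 1}"
  have "mat2.lie_subalgebra ?S"
    unfolding mat2.lie_subalgebra_def mat2.subspace_def
    by (auto simp: mat2_bracket_nth algebra_simps)
  then have "B_alg \<subseteq> ?S"
    unfolding B_alg_def mat2.lie_generated_def
    by (intro hull_minimal) (auto simp: elt_defs)
  then show "A $ 1 $ 2 = 0" "A $ 2 $ 2 = - A $ 1 $ 1"
    using assms by auto
qed

lemma sl2_entries: "A \<in> sl2 \<Longrightarrow> A $ 2 $ 2 = - A $ 1 $ 1"
  by (simp add: sl2_def trace_def sum_2 eq_neg_iff_add_eq_0 add.commute)

lemma letter_val_in_L_comp: "letter_val a \<in> L_comp (letter_type a)"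
  by (cases a) (auto simp: letter_val_def L_comp_def B_alg_generators,
      auto simp: sl2_def elt_defs trace_def sum_2)

lemma zero_in_L_comp: "0 \<in> L_comp t"
  using L_grading mat2_pair.subspace_0 unfolding mat2_pair.grading_def by blast

lemma word_subst_in_L_comp: "word_subst w (i, t) \<in> L_comp t"
  using letter_val_in_L_comp zero_in_L_comp by (auto simp: word_subst_def)

text \<open>Coordinates in the homogeneous basis. In degree 1 the two components agree, so the first
  one suffices.\<close>

fun letter_coord :: "letter \<Rightarrow> 'a::field mat2 \<times> 'a mat2 \<Rightarrow> 'a" where
  "letter_coord T0 x = fst x $ 1 $ 2"
| "letter_coord U0 x = fst x $ 1 $ 1"
| "letter_coord V0 x = fst x $ 2 $ 1"
| "letter_coord U1 x = fst x $ 1 $ 1"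
| "letter_coord V1 x = fst x $ 2 $ 1"

lemma letters_of_type: "{a. letter_type a = 0} = {T0, U0, V0}" "{a. letter_type a = 1} = {U1, V1}"
proof -
  have "letter_type a = 0 \<longleftrightarrow> a \<in> {T0, U0, V0}" "letter_type a = 1 \<longleftrightarrow> a \<in> {U1, V1}" for a
    by (cases a; simp)+
  then show "{a. letter_type a = 0} = {T0, U0, V0}" "{a. letter_type a = 1} = {U1, V1}"
    by blast+
qed

lemma L_comp_expand:
  assumes "x \<in> L_comp t"
  shows "x = (\<Sum>a | letter_type a = t. pair_scale (letter_coord a x) (letter_val a))"
proof (cases t rule: Z2_cases)
  case 1
  then obtain b where "x = (b, 0)" "b \<in> sl2"
    using assms by (auto simp: L_comp_def)
  then show ?thesis
    by (simp add: 1 letters_of_type letter_val_def pair_scale_def mat2_eq_iff elt_defs sl2_entries)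
next
  case 2
  then obtain b where "x = (b, b)" "b \<in> B_alg"
    using assms by (auto simp: L_comp_def)
  then show ?thesis
    by (simp add: 2 letters_of_type letter_val_def pair_scale_def mat2_eq_iff elt_defs B_alg_entries)
qed

section \<open>Left-normed commutators\<close>

context lie_algebra
begin

lemma bracket_0_left [simp]: "bracket 0 x = 0"
  using bracket_scale_left[of 0 0 x] by simp

lemma bracket_0_right [simp]: "bracket x 0 = 0"
  using bracket_scale_right[of x 0 0] by simp

lemma foldl_bracket_add: "foldl bracket (x + y) zs = foldl bracket x zs + foldl bracket y zs"
  by (induction zs arbitrary: x y) (simp_all add: bracket_add_left)

lemma foldl_bracket_scale: "foldl bracket (scale c x) zs = scale c (foldl bracket x zs)"
  by (induction zs arbitrary: x) (simp_all add: bracket_scale_left)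

lemma foldl_bracket_0: "foldl bracket 0 zs = 0"
  by (induction zs) simp_all

lemma left_normed_append:
  "left_normed (xs @ x # ys) =
     foldl bracket (if xs = [] then x else bracket (left_normed xs) x) ys"
  by (cases xs) simp_all

text \<open>Distinctness lets \<open>i\<close> occur exactly once, so the commutator is linear in
  the entry placed there.\<close>

lemma left_normed_linear:
  assumes "distinct ps" "i \<in> set ps"
  shows "module_hom scale scale (\<lambda>x. left_normed (map (\<lambda>p. if p = i then x else g p) ps))"
proof -
  obtain xs ys where ps: "ps = xs @ i # ys" "i \<notin> set xs" "i \<notin> set ys"
    using assms by (metis distinct.simps(2) distinct_append not_distinct_conv_prefix split_list_first disjoint_iff list.set_intros(1))
  have "map (\<lambda>p. if p = i then x else g p) xs = map g xs" for x
    using ps by auto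
  moreover have "map (\<lambda>p. if p = i then x else g p) ys = map g ys" for x
    using ps by auto
  ultimately have "left_normed (map (\<lambda>p. if p = i then x else g p) ps) =
      foldl bracket (if xs = [] then x else bracket (left_normed (map g xs)) x) (map g ys)" for x
    by (simp add: ps left_normed_append del: map_eq_conv)
  then show ?thesis
    by unfold_locales (auto simp: foldl_bracket_add foldl_bracket_scale bracket_add_right bracket_scale_right)
qed

lemma left_normed_in_subalgebra:
  assumes S: "lie_subalgebra S" and xs: "set xs \<subseteq> S"
  shows "left_normed xs \<in> S"
proof -
  have "foldl bracket y ys \<in> S" if "y \<in> S" "set ys \<subseteq> S" for y ys
    using that S by (induction ys arbitrary: y) (simp_all add: lie_subalgebra_def)
  moreover have "0 \<in> S"
    using S by (simp add: lie_subalgebra_def subspace_def)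
  ultimately show ?thesis using xs by (cases xs) simp_all
qed

lemma eval_left_normed: "eval \<phi> (free_lie.left_normed xs) = left_normed (map (eval \<phi>) xs)"
proof -
  have "eval \<phi> (foldl free_bracket y ys) = foldl bracket (eval \<phi> y) (map (eval \<phi>) ys)" for y ys
    by (induction ys arbitrary: y) simp_all
  then show ?thesis by (cases xs) simp_all
qed

end

section \<open>Monomials spanning the multilinear part\<close>

definition monomial :: "nat list \<Rightarrow> (nat \<Rightarrow> 't) \<Rightarrow> ('a::field, nat \<times> 't) free_lie" where
  "monomial ps \<tau> = free_lie.left_normed (map (\<lambda>p. free_var (p, \<tau> p)) ps)"

text \<open>Permutations are traded for rearrangements of the list of indices. In
  \<open>monomial\<close> a degree belongs to the index of a variable, in
  \<open>multilinear_part\<close> to its place in the commutator; composing with the permutation or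
  its inverse converts between the two.\<close>

lemma multilinear_part_eq:
  "multilinear_part n = free_lie.span {monomial ps \<tau> | ps \<tau>. mset ps = mset [1..<Suc n]}"
proof -
  have A: "\<exists>ps \<tau>'. free_lie.left_normed (map (\<lambda>i. free_var (\<sigma> i, \<tau> i)) [1..<n+1]) = monomial ps \<tau>'
      \<and> mset ps = mset [1..<Suc n]" if \<sigma>: "\<sigma> permutes {1..n}" for \<sigma> and \<tau> :: "nat \<Rightarrow> 't"
  proof (intro exI conjI)
    show "free_lie.left_normed (map (\<lambda>i. free_var (\<sigma> i, \<tau> i)) [1..<n+1]) =
        monomial (map \<sigma> [1..<Suc n]) (\<tau> \<circ> inv \<sigma>)"
      using permutes_inverses[OF \<sigma>] by (simp add: monomial_def comp_def del: upt_Suc)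
    have "image_mset \<sigma> (mset_set {1..n}) = mset_set {1..n}"
      using permutes_imp_bij[OF \<sigma>] by (metis bij_betw_def image_mset_mset_set)
    then show "mset (map \<sigma> [1..<Suc n]) = mset [1..<Suc n]"
      by (simp add: atLeastLessThanSuc_atLeastAtMost del: upt_Suc flip: mset_set_upto_eq_mset_upto)
  qed
  have B: "\<exists>\<sigma> \<tau>'. monomial ps \<tau> = free_lie.left_normed (map (\<lambda>i. free_var (\<sigma> i, \<tau>' i)) [1..<n+1])
      \<and> \<sigma> permutes {1..n}" if ps: "mset ps = mset [1..<Suc n]" for ps and \<tau> :: "nat \<Rightarrow> 't"
  proof -
    define \<sigma> where "\<sigma> i = (if i \<in> {1..n} then ps ! (i - 1) else i)" for i
    have len: "length ps = n"
      using mset_eq_length[OF ps] by (simp del: upt_Suc)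
    have set: "set ps = {1..n}"
      using mset_eq_setD[OF ps] by (simp add: atLeastLessThanSuc_atLeastAtMost del: upt_Suc)
    have dist: "distinct ps"
      using mset_eq_imp_distinct_iff[OF ps] by (simp del: upt_Suc)
    have m: "map \<sigma> [1..<Suc n] = ps"
      by (rule nth_equalityI) (auto simp: \<sigma>_def len simp del: upt_Suc)
    have "bij_betw \<sigma> {1..n} {1..n}"
    proof -
      have "inj_on \<sigma> {1..n}"
        using dist by (auto simp: inj_on_def \<sigma>_def nth_eq_iff_index_eq len)
      moreover have "\<sigma> ` {1..n} = {1..n}"
        using m set by (metis atLeastLessThanSuc_atLeastAtMost image_set set_upt)
      ultimately show ?thesis by (simp add: bij_betw_def)
    qed
    then have "\<sigma> permutes {1..n}"
      by (rule bij_imp_permutes) (auto simp: \<sigma>_def)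
    moreover have "monomial (map \<sigma> [1..<Suc n]) \<tau> =
        free_lie.left_normed (map (\<lambda>i. free_var (\<sigma> i, (\<tau> \<circ> \<sigma>) i)) [1..<n+1])"
      by (simp add: monomial_def comp_def del: upt_Suc)
    ultimately show ?thesis
      unfolding m by blast
  qed
  have "{free_lie.left_normed (map (\<lambda>i. free_var (\<sigma> i, \<tau> i)) [1..<n+1]) | \<sigma> \<tau>. \<sigma> permutes {1..n}}
      = {monomial ps \<tau> | ps \<tau>. mset ps = mset [1..<Suc n]}"
    by (intro set_eqI iffI; elim CollectE exE conjE; hypsubst; intro CollectI; rule A B; assumption)
  then show ?thesis unfolding multilinear_part_def by (rule arg_cong)
qed

lemma pair_component_simps [simp]:
  "fst (pair_scale c x) = mat2_scale c (fst x)" "snd (pair_scale c x) = mat2_scale c (snd x)"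
  "fst (pair_bracket x y) = mat2_bracket (fst x) (fst y)"
  "snd (pair_bracket x y) = mat2_bracket (snd x) (snd y)"
  by (simp_all add: pair_scale_def pair_bracket_def)

lemma permuted_set:
  assumes "mset ps = mset [1..<Suc n]"
  shows "set ps = {1..n}" "distinct ps"
  using mset_eq_setD[OF assms] mset_eq_imp_distinct_iff[OF assms]
  by (simp_all add: atLeastLessThanSuc_atLeastAtMost del: upt_Suc)

text \<open>Only the degrees of the indices 1 to \<open>n\<close> enter a monomial, so infinitely
  many \<open>\<tau>\<close> yield finitely many monomials. This makes the multilinear part
  finite-dimensional.\<close>

lemma multilinear_part_finite:
  "finite {monomial ps \<tau> | ps (\<tau> :: nat \<Rightarrow> 2). mset ps = mset [1..<Suc n]}"
proof -
  let ?P = "{ps. mset ps = mset [1..<Suc n]}" and ?T = "PiE {1..n} (\<lambda>_. UNIV :: 2 set)"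
  have "{monomial ps \<tau> | ps (\<tau> :: nat \<Rightarrow> 2). mset ps = mset [1..<Suc n]}
      \<subseteq> (\<lambda>(ps, \<tau>). monomial ps \<tau>) ` (?P \<times> ?T)"
  proof (intro subsetI, elim CollectE exE conjE)
    fix f ps and \<tau> :: "nat \<Rightarrow> 2"
    assume f: "f = monomial ps \<tau>" and ps: "mset ps = mset [1..<Suc n]"
    have "monomial ps \<tau> = monomial ps (restrict \<tau> {1..n})"
      unfolding monomial_def using permuted_set(1)[OF ps]
      by (intro arg_cong[of _ _ free_lie.left_normed] map_cong) simp_all
    then show "f \<in> (\<lambda>(ps, \<tau>). monomial ps \<tau>) ` (?P \<times> ?T)"
      using f ps by (intro image_eqI[of _ _ "(ps, restrict \<tau> {1..n})"]) (simp_all del: upt_Suc)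
  qed
  moreover have "finite (?P \<times> ?T)"
    by (intro finite_cartesian_product finite_PiE mset_eq_finite) simp_all
  ultimately show ?thesis
    by (rule finite_subset[OF _ finite_imageI])
qed

lemma eval_monomial:
  "mat2_pair.eval \<phi> (monomial ps \<tau>) = mat2_pair.left_normed (map (\<lambda>p. \<phi> (p, \<tau> p)) ps)"
  by (simp add: monomial_def mat2_pair.eval_left_normed comp_def)

lemma multilinear_part_induct [consumes 1, case_names monomial zero add scale]:
  assumes "f \<in> multilinear_part n"
    and "\<And>ps \<tau>. mset ps = mset [1..<Suc n] \<Longrightarrow> P (monomial ps \<tau>)"
    and "P 0" and "\<And>f g. P f \<Longrightarrow> P g \<Longrightarrow> P (f + g)" and "\<And>c f. P f \<Longrightarrow> P (free_scale c f)"
  shows "P f"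
  using assms(1) unfolding multilinear_part_eq
  by (induction rule: free_lie.span_induct_alt) (use assms in auto)

section \<open>Reduction of graded identities to values on words\<close>

lemma eval_cong_multilinear:
  assumes "f \<in> multilinear_part n" and "\<And>i t. i \<in> {1..n} \<Longrightarrow> \<phi> (i, t) = \<psi> (i, t)"
  shows "mat2_pair.eval \<phi> f = mat2_pair.eval \<psi> f"
  using assms(1)
proof (induction rule: multilinear_part_induct)
  case (monomial ps \<tau>)
  then show ?case
    unfolding eval_monomial using permuted_set(1)[OF monomial] assms(2)
    by (intro arg_cong[of _ _ mat2_pair.left_normed] map_cong) simp_all
qed simp_all

text \<open>Each monomial contains exactly one variable with index \<open>i\<close> and is linear in
  it. A letter of the other degree puts 0 there, so one sum over all five letters serves monomials
  of either degree.\<close>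

lemma eval_multilinear_expand:
  fixes f :: "('a::field, nat \<times> 2) free_lie"
  assumes "f \<in> multilinear_part n" and i: "i \<in> {1..n}" and \<phi>: "\<And>t. \<phi> (i, t) \<in> L_comp t"
  shows "mat2_pair.eval \<phi> f = (\<Sum>a\<in>UNIV. pair_scale (letter_coord a (\<phi> (i, letter_type a)))
    (mat2_pair.eval (\<lambda>(j, t). if j = i then if t = letter_type a then letter_val a else 0 else \<phi> (j, t)) f))"
    (is "_ = (\<Sum>a\<in>UNIV. pair_scale (?c a) (mat2_pair.eval (?\<phi> a) f))")
  using assms(1)
proof (induction rule: multilinear_part_induct)
  case (monomial ps \<tau>)
  note ps = permuted_set[OF monomial]
  let ?D = "\<lambda>x. mat2_pair.left_normed (map (\<lambda>p. if p = i then x else \<phi> (p, \<tau> p)) ps)"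
  interpret D: module_hom pair_scale pair_scale ?D
    using mat2_pair.left_normed_linear[of ps i "\<lambda>p. \<phi> (p, \<tau> p)"] ps i by simp
  have 1: "mat2_pair.eval (?\<phi> a) (monomial ps \<tau>) = (if \<tau> i = letter_type a then ?D (letter_val a) else 0)" for a
  proof -
    have "mat2_pair.eval (?\<phi> a) (monomial ps \<tau>) = ?D (if \<tau> i = letter_type a then letter_val a else 0)"
      unfolding eval_monomial by (intro arg_cong[of _ _ mat2_pair.left_normed] map_cong) auto
    then show ?thesis using D.zero by simp
  qed
  have "mat2_pair.eval \<phi> (monomial ps \<tau>) = ?D (\<phi> (i, \<tau> i))"
    unfolding eval_monomial by (intro arg_cong[of _ _ mat2_pair.left_normed] map_cong) auto
  also have "\<dots> = ?D (\<Sum>a | letter_type a = \<tau> i. pair_scale (letter_coord a (\<phi> (i, \<tau> i))) (letter_val a))"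
    by (rule arg_cong[of _ _ ?D]) (rule L_comp_expand[OF \<phi>])
  also have "\<dots> = (\<Sum>a | letter_type a = \<tau> i. pair_scale (?c a) (?D (letter_val a)))"
    by (simp add: D.sum D.scale)
  also have "\<dots> = (\<Sum>a\<in>UNIV. pair_scale (?c a) (mat2_pair.eval (?\<phi> a) (monomial ps \<tau>)))"
    unfolding 1 by (rule sum.mono_neutral_cong_left) auto
  finally show ?case .
qed (simp_all add: mat2_pair.scale_right_distrib sum.distrib mat2_pair.scale_sum_right
    mult.commute)

lemma graded_identity_if_vanishes_on_words:
  fixes f :: "('a::field, nat \<times> 2) free_lie"
  assumes f: "f \<in> multilinear_part n"
    and van: "\<And>w. length w = n \<Longrightarrow> mat2_pair.eval (word_subst w) f = 0"
  shows "f \<in> mat2_pair.graded_identities L_comp"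
  unfolding mat2_pair.graded_identities_def
proof (intro CollectI allI impI)
  fix \<phi> :: "nat \<times> 2 \<Rightarrow> 'a mat2 \<times> 'a mat2"
  assume \<phi>: "\<forall>i t. \<phi> (i, t) \<in> L_comp t"
  \<comment> \<open>A hybrid substitution: variables with index at most \<open>k\<close> keep their
    values under \<open>\<phi>\<close>, the later ones take those of the word. Raising
    \<open>k\<close> by one means expanding a single value in the homogeneous basis.\<close>
  define mix where "mix w k = (\<lambda>(i, t). if k < i \<and> i \<le> n then word_subst w (i, t) else \<phi> (i, t))" for w k
  have mix: "mix w k (i, t) \<in> L_comp t" for w k i t
    using \<phi> by (auto simp: mix_def word_subst_in_L_comp)
  have "mat2_pair.eval (mix w k) f = 0" if "length w = n" "k \<le> n" for w k
    using that
  proof (induction k arbitrary: w)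
    case 0
    have "mat2_pair.eval (mix w 0) f = mat2_pair.eval (word_subst w) f"
      by (rule eval_cong_multilinear[OF f]) (simp add: mix_def)
    then show ?case using van 0 by simp
  next
    case (Suc k)
    \<comment> \<open>Position \<open>k\<close> of the word, counted from 0, feeds the variable with
      index \<open>Suc k\<close>.\<close>
    have "(\<lambda>(j, t). if j = Suc k then if t = letter_type a then letter_val a else 0 else mix w (Suc k) (j, t))
        = mix (w[k := a]) k" for a
    proof -
      have "word_subst w (j, t) = (word_subst (w[k := a]) (j, t) :: 'a mat2 \<times> 'a mat2)" if "Suc k < j" for j t
        using that by (simp add: word_subst_def)
      moreover have "word_subst (w[k := a]) (Suc k, t) = (if t = letter_type a then letter_val a else 0 :: 'a mat2 \<times> 'a mat2)" for t
        using Suc.prems by (simp add: word_subst_def)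
      ultimately show ?thesis
        using Suc.prems by (auto simp: mix_def fun_eq_iff)
    qed
    then show ?case
      using Suc by (subst eval_multilinear_expand[OF f, of "Suc k"]) (auto simp: mix)
  qed
  \<comment> \<open>At \<open>k = n\<close> the word no longer enters, so any word of length
    \<open>n\<close> will do.\<close>
  from this[of "replicate n T0" n] have "mat2_pair.eval (mix (replicate n T0) n) f = 0"
    by simp
  moreover have "mix (replicate n T0) n = \<phi>"
    by (auto simp: mix_def fun_eq_iff)
  ultimately show "mat2_pair.eval \<phi> f = 0" by simp
qed

section \<open>Weight spaces\<close>

definition weight_space :: "int \<Rightarrow> 'a::field mat2 set" where
  "weight_space k = {A. A $ 2 $ 2 = - A $ 1 $ 1 \<and> (k \<noteq> 1 \<longrightarrow> A $ 1 $ 2 = 0) \<and> (k \<noteq> 0 \<longrightarrow> A $ 1 $ 1 = 0)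
     \<and> (k \<noteq> -1 \<longrightarrow> A $ 2 $ 1 = 0)}"

text \<open>Outside -1, 0, 1 the weight spaces are zero, so finitely many cases remain. In weights 2
  and -2 the bracket vanishes, as it involves two multiples of the same matrix.\<close>

lemma weight_space_bracket:
  assumes "A \<in> weight_space j" "B \<in> weight_space k"
  shows "mat2_bracket A B \<in> weight_space (j + k)"
proof (cases "j \<in> {-1, 0, 1} \<and> k \<in> {-1, 0, 1}")
  case True
  then have "j = -1 \<or> j = 0 \<or> j = 1" "k = -1 \<or> k = 0 \<or> k = 1" by auto
  then show ?thesis using assms
    by (elim disjE; simp add: weight_space_def mat2_bracket_nth)
next
  case False
  then have "A = 0 \<or> B = 0"
    using assms by (auto simp: weight_space_def mat2_eq_iff)
  then show ?thesis by (auto simp: weight_space_def)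
qed

lemma weight_space_simps:
  "0 \<in> weight_space k"
  "A \<in> weight_space k \<Longrightarrow> B \<in> weight_space k \<Longrightarrow> A + B \<in> weight_space k"
  "A \<in> weight_space k \<Longrightarrow> mat2_scale c A \<in> weight_space k"
  by (auto simp: weight_space_def)

lemma letter_mat_weight: "letter_mat a \<in> weight_space (weight a)"
  by (cases a) (simp_all add: weight_space_def elt_defs)

lemma left_normed_weight:
  assumes "\<And>p. p \<in> set ps \<Longrightarrow> fst (g p) \<in> weight_space (\<omega> p)"
  shows "fst (mat2_pair.left_normed (map g ps)) \<in> weight_space (sum_list (map \<omega> ps))"
proof (cases ps)
  case Nil
  then show ?thesis by (simp add: weight_space_simps)
next
  case (Cons q qs)
  have "fst (foldl pair_bracket y (map g qs)) \<in> weight_space (j + sum_list (map \<omega> qs))"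
    if "fst y \<in> weight_space j" "\<And>p. p \<in> set qs \<Longrightarrow> fst (g p) \<in> weight_space (\<omega> p)" for y j
    using that
  proof (induction qs arbitrary: y j)
    case (Cons q qs)
    have "fst (pair_bracket y (g q)) \<in> weight_space (j + \<omega> q)"
      using Cons.prems by (simp add: weight_space_bracket)
    from Cons.IH[OF this] Cons.prems show ?case by (simp add: add.assoc)
  qed simp
  with assms Cons show ?thesis by auto
qed

lemma sum_list_weight_permuted:
  fixes g :: "letter \<Rightarrow> 'b::comm_monoid_add"
  assumes "mset ps = mset [1..<Suc n]" "length w = n"
  shows "sum_list (map (\<lambda>p. g (w ! (p - 1))) ps) = sum_list (map g w)"
proof -
  have "sum_list (map (\<lambda>p. g (w ! (p - 1))) ps) = sum_mset (image_mset (\<lambda>p. g (w ! (p - 1))) (mset ps))"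
    by (metis mset_map sum_mset_sum_list)
  also have "\<dots> = sum_list (map (\<lambda>p. g (w ! (p - 1))) [1..<Suc n])"
    unfolding assms(1) by (metis mset_map sum_mset_sum_list)
  also have "map (\<lambda>p. g (w ! (p - 1))) [1..<Suc n] = map g w"
    by (rule nth_equalityI) (auto simp: assms(2) simp del: upt_Suc)
  finally show ?thesis .
qed

lemma word_eval_weight:
  assumes "f \<in> multilinear_part n" "length w = n"
  shows "fst (mat2_pair.eval (word_subst w) f) \<in> weight_space (sum_list (map weight w))"
  using assms(1)
proof (induction rule: multilinear_part_induct)
  case (monomial ps \<tau>)
  have "fst (word_subst w (p, \<tau> p)) \<in> weight_space (weight (w ! (p - 1)))" for p
    by (auto simp: word_subst_def letter_val_def letter_mat_weight weight_space_simps)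
  then have "fst (mat2_pair.left_normed (map (\<lambda>p. word_subst w (p, \<tau> p)) ps))
      \<in> weight_space (\<Sum>p\<leftarrow>ps. weight (w ! (p - 1)))"
    by (rule left_normed_weight)
  then show ?case
    by (simp only: eval_monomial sum_list_weight_permuted[OF monomial assms(2)])
qed (simp_all add: weight_space_simps)

lemma snd_left_normed_eq_0:
  assumes "x \<in> set xs" "snd x = 0"
  shows "snd (mat2_pair.left_normed xs) = 0"
proof -
  obtain ys zs where "xs = ys @ x # zs"
    using assms(1) split_list by metis
  moreover have "snd (foldl pair_bracket y zs) = 0" if "snd y = 0" for y
    using that by (induction zs arbitrary: y) simp_all
  ultimately show ?thesis
    using assms(2) by (simp add: mat2_pair.left_normed_append)
qed

text \<open>A letter of degree 0 makes the second component of the value vanish; if all letters have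
  degree 1, the two components agree. Either way the first component decides.\<close>

lemma word_eval_eq_0:
  assumes f: "f \<in> multilinear_part n" and w: "length w = n"
    and z: "fst (mat2_pair.eval (word_subst w) f) = 0"
  shows "mat2_pair.eval (word_subst w) f = 0"
proof (cases "\<forall>a\<in>set w. letter_type a \<noteq> 0")
  case True
  let ?S = "{x. fst x = snd x}"
  have S: "mat2_pair.lie_subalgebra ?S"
    unfolding mat2_pair.lie_subalgebra_def mat2_pair.subspace_def
    by auto
  have v: "word_subst w (i, t) \<in> ?S" for i t
    using True by (auto simp: word_subst_def letter_val_def)
  have "mat2_pair.eval (word_subst w) f \<in> ?S"
    using f
  proof (induction rule: multilinear_part_induct)
    case (monomial ps \<tau>)
    then show ?case
      unfolding eval_monomial using v by (intro mat2_pair.left_normed_in_subalgebra[OF S]) auto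
  qed auto
  then show ?thesis using z by (simp add: prod_eq_iff)
next
  case False
  then obtain i where i: "i < n" "letter_type (w ! i) = 0"
    using w by (auto simp: in_set_conv_nth)
  then have v: "snd (word_subst w (Suc i, t)) = 0" for t
    by (simp add: word_subst_def letter_val_def)
  have "snd (mat2_pair.eval (word_subst w) f) = 0"
    using f
  proof (induction rule: multilinear_part_induct)
    case (monomial ps \<tau>)
    have "Suc i \<in> set ps"
      using permuted_set(1)[OF monomial] i by simp
    then show ?case
      unfolding eval_monomial using v by (intro snd_left_normed_eq_0[of "word_subst w (Suc i, \<tau> (Suc i))"]) auto
  qed auto
  then show ?thesis using z by (simp add: prod_eq_iff)
qed

text \<open>The coordinate on a one-dimensional weight space. The last branch is meant for
  \<open>k = -1\<close>.\<close>

definition weight_coord :: "int \<Rightarrow> 'a::field mat2 \<Rightarrow> 'a" where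
  "weight_coord k A = (if k = 1 then A $ 1 $ 2 else if k = 0 then A $ 1 $ 1 else A $ 2 $ 1)"

lemma weight_space_eq_0:
  assumes "A \<in> weight_space k" "\<bar>k\<bar> \<le> 1 \<Longrightarrow> weight_coord k A = 0"
  shows "A = 0"
  using assms by (auto simp: weight_space_def weight_coord_def mat2_eq_iff split: if_splits)

section \<open>Upper bound by the number of words of small weight\<close>

definition codim_words :: "nat \<Rightarrow> letter list set" where
  "codim_words n = {w. length w = n \<and> \<bar>sum_list (map weight w)\<bar> \<le> 1}"

lemma finite_words: "finite {w :: letter list. length w = n}"
  using finite_lists_length_eq[of "UNIV :: letter set" n] by simp

lemma multilinear_part_subspace: "free_lie.subspace (multilinear_part n)"
  unfolding multilinear_part_def by (rule free_lie.subspace_span)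

lemma multilinear_identities_subspace:
  "free_lie.subspace (multilinear_part n \<inter> mat2_pair.graded_identities G)"
  by (intro free_lie.subspace_inter multilinear_part_subspace)
    (simp add: free_lie.subspace_def mat2_pair.graded_identities_def)

lemma multilinear_part_span_finite:
  "\<exists>T. finite T \<and> (multilinear_part n :: ('a::field, nat \<times> 2) free_lie set) \<subseteq> free_lie.span T"
  using multilinear_part_finite[of n] unfolding multilinear_part_eq by auto

text \<open>Each word in \<open>codim_words n\<close> contributes one functional, the coordinate of
  the value in its weight space. On all other words the value is zero anyway, so the common kernel
  consists of identities.\<close>

lemma graded_codim_le:
  "mat2_pair.graded_codim (L_comp :: 2 \<Rightarrow> ('a::field mat2 \<times> 'a mat2) set) n \<le> card (codim_words n)"
proof -
  let ?V = "multilinear_part n :: ('a, nat \<times> 2) free_lie set"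
  let ?g = "\<lambda>w f. weight_coord (sum_list (map weight w)) (fst (mat2_pair.eval (word_subst w) f)) :: 'a"
  have hom: "module_hom free_scale (*) (?g w)" for w
    by unfold_locales (auto simp: weight_coord_def algebra_simps)
  have fin: "finite (codim_words n)"
    by (rule finite_subset[OF _ finite_words[of n]]) (auto simp: codim_words_def)
  obtain S where S: "finite S" "card S \<le> card (?g ` codim_words n)"
      "?V \<subseteq> free_lie.span (S \<union> {f \<in> ?V. \<forall>g\<in>?g ` codim_words n. g f = 0})"
    using free_lie.span_functionals[OF finite_imageI[OF fin] multilinear_part_subspace, of ?g n] hom
    by blast
  have "{f \<in> ?V. \<forall>g\<in>?g ` codim_words n. g f = 0} \<subseteq> ?V \<inter> mat2_pair.graded_identities L_comp"
  proof
    fix f assume "f \<in> {f \<in> ?V. \<forall>g\<in>?g ` codim_words n. g f = 0}"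
    then have f: "f \<in> ?V" and g: "\<forall>g\<in>?g ` codim_words n. g f = 0" by simp_all
    have "mat2_pair.eval (word_subst w) f = 0" if w: "length w = n" for w
    proof (rule word_eval_eq_0[OF f w])
      show "fst (mat2_pair.eval (word_subst w) f) = 0"
        using g w by (intro weight_space_eq_0[OF word_eval_weight[OF f w]]) (auto simp: codim_words_def)
    qed
    then show "f \<in> ?V \<inter> mat2_pair.graded_identities L_comp"
      using f graded_identity_if_vanishes_on_words by blast
  qed
  then have "?V \<subseteq> free_lie.span (S \<union> (?V \<inter> mat2_pair.graded_identities L_comp))"
    using S(3) free_lie.span_mono[OF Un_mono[OF subset_refl]] by blast
  moreover obtain T where "finite T" "?V \<subseteq> free_lie.span T"
    using multilinear_part_span_finite by blast
  ultimately have "free_lie.quotient_dim ?V (?V \<inter> mat2_pair.graded_identities L_comp) \<le> card S"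
    using free_lie.quotient_dim_le[OF multilinear_identities_subspace Int_lower1 multilinear_part_subspace _ _ S(1)]
    by blast
  then have "mat2_pair.graded_codim (L_comp :: 2 \<Rightarrow> ('a mat2 \<times> 'a mat2) set) n \<le> card S"
    by (simp add: mat2_pair.graded_codim_def)
  also have "\<dots> \<le> card (codim_words n)"
    using S(2) card_image_le[OF fin, of ?g] by linarith
  finally show ?thesis .
qed

section \<open>Counting words by weight\<close>

lemma sum_prod_list_words:
  fixes x :: "letter \<Rightarrow> 'b::comm_semiring_1"
  shows "(\<Sum>w | length w = n. prod_list (map x w)) = (\<Sum>a\<in>UNIV. x a) ^ n"
proof (induction n)
  case (Suc n)
  have eq: "{w. length w = Suc n} = (\<lambda>(a, w). a # w) ` (UNIV \<times> {w :: letter list. length w = n})"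
    by (auto simp: length_Suc_conv image_iff)
  have "(\<Sum>w | length w = Suc n. prod_list (map x w))
      = (\<Sum>(a, w)\<in>UNIV \<times> {w. length w = n}. x a * prod_list (map x w))"
    unfolding eq by (subst sum.reindex) (auto simp: inj_on_def case_prod_unfold)
  also have "\<dots> = (\<Sum>a\<in>UNIV. x a) * (\<Sum>w | length w = n. prod_list (map x w))"
    by (simp add: sum_product sum.cartesian_product)
  finally show ?case by (simp add: Suc)
qed simp

text \<open>The terms of z + 2 + 2/z at its minimum point sqrt 2, one for each letter. Up to
  scaling, they are also the letter frequencies aimed at in the lower bound.\<close>

definition letter_weight :: "letter \<Rightarrow> real" where
  "letter_weight a = sqrt 2 powi weight a"

lemma sum_letter_weight: "(\<Sum>a\<in>UNIV. letter_weight a) = 2 + 2 * sqrt 2"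
proof -
  have "inverse (sqrt 2) = sqrt 2 / 2"
    by (simp add: field_simps)
  then show ?thesis
    by (simp add: UNIV_letter letter_weight_def power_int_minus)
qed

lemma prod_list_letter_weight: "prod_list (map letter_weight w) = sqrt 2 powi sum_list (map weight w)"
  by (induction w) (simp_all add: letter_weight_def power_int_add)

text \<open>A word that is counted has weight at least -1, hence contributes at least 1 / sqrt 2 to
  the sum of \<open>prod_list (map letter_weight w)\<close> over all words of length
  \<open>n\<close>.\<close>

lemma card_codim_words_le: "real (card (codim_words n)) \<le> sqrt 2 * (2 + 2 * sqrt 2) ^ n"
proof -
  have "1 \<le> sqrt 2 * prod_list (map letter_weight w)" if "w \<in> codim_words n" for w
  proof -
    have "sqrt 2 powi (-1) \<le> sqrt 2 powi sum_list (map weight w)"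
      using that by (intro power_int_increasing) (auto simp: codim_words_def)
    then show ?thesis
      by (simp add: prod_list_letter_weight power_int_minus field_simps)
  qed
  then have "real (card (codim_words n)) \<le> (\<Sum>w\<in>codim_words n. sqrt 2 * prod_list (map letter_weight w))"
    using sum_mono[of "codim_words n" "\<lambda>_. 1::real"] by fastforce
  also have "\<dots> \<le> (\<Sum>w | length w = n. sqrt 2 * prod_list (map letter_weight w))"
    by (rule sum_mono2[OF finite_words]) (auto simp: codim_words_def prod_list_letter_weight)
  also have "\<dots> = sqrt 2 * (2 + 2 * sqrt 2) ^ n"
    by (simp add: sum_prod_list_words sum_letter_weight flip: sum_distrib_left)
  finally show ?thesis .
qed

section \<open>Column polynomials of ballot words\<close>

text \<open>The alternating sum of \<open>ad a\<^sub>1 \<dots> ad a\<^sub>k\<close>, acting on \<open>z\<close> from the right; only \<open>k = 1, 2, 3\<close> occur, all other cases are junk.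
  On \<open>\<ss>\<ll>\<^sub>2\<close>, the case \<open>k = 2\<close> is \<open>ad [a\<^sub>1, a\<^sub>2]\<close> and the case \<open>k = 3\<close> is a multiple of the identity.\<close>

fun alt_ad :: "('b::ab_group_add \<Rightarrow> 'b \<Rightarrow> 'b) \<Rightarrow> 'b \<Rightarrow> 'b list \<Rightarrow> 'b" where
  "alt_ad br z [a] = br z a"
| "alt_ad br z [a, b] = br (br z a) b - br (br z b) a"
| "alt_ad br z [a, b, c] =
     foldl br z [a, b, c] + foldl br z [b, c, a] + foldl br z [c, a, b]
     - foldl br z [b, a, c] - foldl br z [a, c, b] - foldl br z [c, b, a]"
| "alt_ad br z _ = 0"

context lie_algebra
begin

lemma alt_ad_0: "alt_ad bracket 0 c = 0"
  by (cases "(bracket, 0 :: 'b, c)" rule: alt_ad.cases) simp_all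

lemma foldl_alt_ad_0: "foldl (alt_ad bracket) 0 cs = 0"
  by (induction cs) (simp_all add: alt_ad_0)

lemma alt_ad_hom:
  assumes "\<And>x y. h (x + y) = h x + h y" "\<And>x y. h (br x y) = bracket (h x) (h y)"
  shows "h (alt_ad br z c) = alt_ad bracket (h z) (map h c)"
proof -
  have 0: "h 0 = 0"
    using assms(1)[of 0 0] by simp
  have m: "h (x - y) = h x - h y" for x y
    using assms(1)[of "x - y" y] by simp
  show ?thesis
    by (cases "(br, z, c)" rule: alt_ad.cases) (simp_all add: assms m 0)
qed

text \<open>The alternating sum is linear in \<open>z\<close>, so generators suffice, and each of
  its terms uses a rearrangement of the column.\<close>

lemma alt_ad_in_span:
  assumes z: "z \<in> span S"
    and S: "\<And>s ys. s \<in> S \<Longrightarrow> mset ys = mset c \<Longrightarrow> foldl bracket s ys \<in> span S'"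
  shows "alt_ad bracket z c \<in> span S'"
proof -
  have "foldl bracket z ys \<in> span S'" if "mset ys = mset c" for ys
    using z
  proof (induction rule: span_induct_alt)
    case base
    then show ?case by (simp add: foldl_bracket_0 span_zero)
  next
    case (step a s y)
    then show ?case
      using S[OF _ that] by (simp add: foldl_bracket_add foldl_bracket_scale span_add span_scale)
  qed
  note f = this
  show ?thesis
  proof (cases "(bracket, z, c)" rule: alt_ad.cases)
    case (1 br z a)
    then show ?thesis using f[of "[a]"] by simp
  next
    case (2 br z a b)
    then show ?thesis using f[of "[a, b]"] f[of "[b, a]"] by (simp add: span_diff)
  next
    case (3 br z a b d)
    then show ?thesis
      using f[of "[a, b, d]"] f[of "[b, d, a]"] f[of "[d, a, b]"] f[of "[b, a, d]"] f[of "[a, d, b]"] f[of "[d, b, a]"]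
      by (simp add: span_diff span_add)
  qed (simp_all add: span_zero)
qed

lemma foldl_alt_ad_in_span:
  "foldl (alt_ad bracket) y cs \<in> span {foldl bracket y xs | xs. mset xs = mset (concat cs)}"
proof (induction cs rule: rev_induct)
  case Nil
  then show ?case by (intro span_base) auto
next
  case (snoc c cs)
  have "foldl bracket s ys \<in> span {foldl bracket y xs | xs. mset xs = mset (concat (cs @ [c]))}"
    if "s \<in> {foldl bracket y xs | xs. mset xs = mset (concat cs)}" and "mset ys = mset c" for s ys
  proof -
    from that obtain xs where "s = foldl bracket y xs" "mset xs = mset (concat cs)" by blast
    then have "foldl bracket s ys = foldl bracket y (xs @ ys)" "mset (xs @ ys) = mset (concat (cs @ [c]))"
      using that(2) by simp_all
    then show ?thesis by (intro span_base CollectI exI[of _ "xs @ ys"] conjI)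
  qed
  then show ?case
    using alt_ad_in_span[OF snoc.IH] by simp
qed

end

text \<open>Position \<open>p\<close> of the word carries the variable with index \<open>p + 1\<close>; the innermost variable, with
  index \<open>length w + 1\<close>, is meant to be evaluated at \<open>(t,0)\<close>.\<close>

definition column_poly :: "letter list \<Rightarrow> nat list list \<Rightarrow> ('a::field, nat \<times> 2) free_lie" where
  "column_poly w cs = foldl (alt_ad free_bracket) (free_var (Suc (length w), 0))
     (map (map (\<lambda>p. free_var (Suc p, letter_type (w ! p)))) cs)"

lemma mset_eq_map:
  assumes "mset xs = mset (map f ys)"
  obtains zs where "mset zs = mset ys" "xs = map f zs"
proof -
  obtain \<sigma> where \<sigma>: "\<sigma> permutes {..<length (map f ys)}" "permute_list \<sigma> (map f ys) = xs"
    by (rule mset_eq_permutation[OF assms])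
  show thesis
    by (rule that[of "permute_list \<sigma> ys"]) (use \<sigma> in \<open>simp_all add: permute_list_map\<close>)
qed

text \<open>Expanding the alternating sums gives commutators that start with the innermost variable,
  of index \<open>Suc (length w)\<close> and degree 0, followed by a rearrangement of the other
  variables.\<close>

lemma column_poly_multilinear:
  assumes "mset (concat cs) = mset [0..<length w]"
  shows "column_poly w cs \<in> multilinear_part (Suc (length w))"
proof -
  let ?n = "Suc (length w)" and ?var = "\<lambda>p. free_var (Suc p, letter_type (w ! p)) :: ('a, nat \<times> 2) free_lie"
  let ?\<tau> = "\<lambda>p. if p = ?n then 0 else letter_type (w ! (p - 1))"
  let ?G = "{monomial ps \<tau> :: ('a, nat \<times> 2) free_lie | ps \<tau>. mset ps = mset [1..<Suc ?n]}"
  have sub: "{foldl free_bracket (free_var (?n, 0)) xs | xs. mset xs = mset (concat (map (map ?var) cs))} \<subseteq> ?G"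
  proof (intro subsetI, elim CollectE exE conjE)
    fix f xs assume f: "f = foldl free_bracket (free_var (?n, 0)) xs"
      and "mset xs = mset (concat (map (map ?var) cs))"
    then have "mset xs = mset (map ?var [0..<length w])"
      using assms by (metis map_concat mset_map)
    then obtain zs where zs: "mset zs = mset [0..<length w]" "xs = map ?var zs"
      by (rule mset_eq_map)
    have "mset (map Suc zs) = mset (map Suc [0..<length w])"
      unfolding mset_map zs(1) ..
    then have "mset (?n # map Suc zs) = mset [1..<Suc ?n]"
      unfolding map_Suc_upt by simp
    moreover have "set zs = {0..<length w}"
      using mset_eq_setD[OF zs(1)] by simp
    then have "f = monomial (?n # map Suc zs) ?\<tau>"
      by (auto simp: f monomial_def zs(2) intro!: arg_cong[of _ _ "foldl free_bracket (free_var (?n, 0))"])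
    ultimately show "f \<in> ?G" by blast
  qed
  show ?thesis
    unfolding column_poly_def multilinear_part_eq
    by (rule subsetD[OF free_lie.span_mono[OF sub] free_lie.foldl_alt_ad_in_span])
qed

text \<open>The value at a letter \<open>b\<close> of a variable that has the degree of the letter \<open>a\<close>.\<close>

definition seen_mat :: "letter \<Rightarrow> letter \<Rightarrow> 'a::field mat2" where
  "seen_mat a b = (if letter_type a = letter_type b then letter_mat b else 0)"

lemma eval_column_poly:
  assumes "length w' = length w" "mset (concat cs) = mset [0..<length w]"
  shows "fst (mat2_pair.eval (word_subst (w' @ [T0])) (column_poly w cs)) =
    foldl (alt_ad mat2_bracket) t_elt (map (map (\<lambda>p. seen_mat (w ! p) (w' ! p))) cs)"
proof -
  let ?h = "\<lambda>f. fst (mat2_pair.eval (word_subst (w' @ [T0])) f)"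
  have fold: "?h (foldl (alt_ad free_bracket) y ds) = foldl (alt_ad mat2_bracket) (?h y) (map (map ?h) ds)" for y ds
    by (induction ds arbitrary: y) (simp_all add: mat2.alt_ad_hom[of ?h])
  have "map (map ?h) (map (map (\<lambda>p. free_var (Suc p, letter_type (w ! p)))) cs)
      = map (map (\<lambda>p. ?h (free_var (Suc p, letter_type (w ! p))))) cs"
    by (simp add: comp_def)
  also have "\<dots> = map (map (\<lambda>p. seen_mat (w ! p) (w' ! p))) cs"
  proof (rule map_cong[OF HOL.refl], rule map_cong[OF HOL.refl])
    fix c p assume "c \<in> set cs" "p \<in> set c"
    then have "p < length w"
      using mset_eq_setD[OF assms(2)] by auto
    then show "?h (free_var (Suc p, letter_type (w ! p))) = seen_mat (w ! p) (w' ! p)"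
      using assms(1) by (simp add: word_subst_def letter_val_def seen_mat_def nth_append)
  qed
  finally have 1: "map (map ?h) (map (map (\<lambda>p. free_var (Suc p, letter_type (w ! p)))) cs)
      = map (map (\<lambda>p. seen_mat (w ! p) (w' ! p))) cs" .
  have 2: "?h (free_var (Suc (length w), 0)) = t_elt"
    using assms(1) by (simp add: word_subst_def letter_val_def nth_append)
  show ?thesis
    unfolding column_poly_def fold 1 2 ..
qed

section \<open>Triangularity of the evaluation matrix\<close>

fun letter_rank :: "letter \<Rightarrow> nat" where
  "letter_rank T0 = 0" | "letter_rank U0 = 1" | "letter_rank V0 = 2" | "letter_rank U1 = 1" | "letter_rank V1 = 2"

text \<open>Among all ways to permute the letters within increasing columns, the potential is largest
  exactly for the sorted one.\<close>

definition potential :: "letter list \<Rightarrow> nat" where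
  "potential w = (\<Sum>p\<leftarrow>[0..<length w]. p * letter_rank (w ! p))"

text \<open>The nonempty initial segments of \<open>T0\<close>, \<open>U0\<close>, \<open>V0\<close>
  and of \<open>U1\<close>, \<open>V1\<close>. Along each of them \<open>letter_rank\<close>
  increases.\<close>

definition column_patterns :: "letter list set" where
  "column_patterns = {[T0], [T0, U0], [T0, U0, V0], [U1], [U1, V1]}"

definition is_column :: "letter list \<Rightarrow> nat list \<Rightarrow> bool" where
  "is_column w c \<longleftrightarrow> sorted_wrt (<) c \<and> map (nth w) c \<in> column_patterns"

text \<open>Together with the rules for a zero entry, this disposes of all but six of the 125 letter
  triples for a column of length three before any matrix is computed.\<close>

lemma alt_ad_repeated:
  "alt_ad br z [a, a] = 0"
  "alt_ad br z [a, a, b] = 0" "alt_ad br z [a, b, a] = 0" "alt_ad br z [b, a, a] = 0"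
  by simp_all

lemma alt_ad_zero_entry:
  "alt_ad mat2_bracket z [0] = 0" "alt_ad mat2_bracket z [0, b] = 0" "alt_ad mat2_bracket z [b, 0] = 0"
  "alt_ad mat2_bracket z [0, b, c] = 0" "alt_ad mat2_bracket z [b, 0, c] = 0"
  "alt_ad mat2_bracket z [b, c, 0] = 0"
  by simp_all

text \<open>A nonzero alternating sum needs distinct letters of the degree of the column. Among such
  choices each pattern has the largest weight, and equal weight forces a permutation of its letters.
  As the positions increase along the column, the rearrangement inequality makes the sorted order
  the unique maximum of the potential.\<close>

lemma column_nonzero:
  assumes c: "is_column w c"
    and nz: "alt_ad mat2_bracket z (map (\<lambda>p. seen_mat (w ! p) (w' ! p)) c) \<noteq> 0"
  shows "(\<Sum>p\<leftarrow>c. weight (w' ! p)) \<le> (\<Sum>p\<leftarrow>c. weight (w ! p))"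
    and "(\<Sum>p\<leftarrow>c. weight (w' ! p)) = (\<Sum>p\<leftarrow>c. weight (w ! p)) \<Longrightarrow>
      map (nth w') c = map (nth w) c \<or> (\<Sum>p\<leftarrow>c. p * letter_rank (w' ! p)) < (\<Sum>p\<leftarrow>c. p * letter_rank (w ! p))"
proof -
  note c' = c[unfolded is_column_def column_patterns_def]
  have "(\<Sum>p\<leftarrow>c. weight (w' ! p)) \<le> (\<Sum>p\<leftarrow>c. weight (w ! p)) \<and>
    ((\<Sum>p\<leftarrow>c. weight (w' ! p)) = (\<Sum>p\<leftarrow>c. weight (w ! p)) \<longrightarrow>
      map (nth w') c = map (nth w) c \<or> (\<Sum>p\<leftarrow>c. p * letter_rank (w' ! p)) < (\<Sum>p\<leftarrow>c. p * letter_rank (w ! p)))"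
  proof (cases "length c = 3")
    case True
    then obtain p q r where pqr: "c = [p, q, r]"
      by (auto simp: numeral_3_eq_3 length_Suc_conv)
    then have w: "w ! p = T0" "w ! q = U0" "w ! r = V0" and lt: "p < q" "q < r"
      using c' by auto
    show ?thesis
      using nz lt unfolding pqr list.map w
      by (cases "w' ! p"; cases "w' ! q"; cases "w' ! r";
          simp only: seen_mat_def letter_type.simps letter_mat.simps alt_ad_repeated alt_ad_zero_entry
            if_True if_False simp_thms zero_neq_one one_neq_zero sum_list.Cons sum_list.Nil weight.simps letter_rank.simps;
          simp)
  next
    case False
    show ?thesis
    proof (cases "length c = 2")
      case True
      then obtain p q where pq: "c = [p, q]"
        by (auto simp: numeral_2_eq_2 length_Suc_conv)
      then have w: "w ! p = T0 \<and> w ! q = U0 \<or> w ! p = U1 \<and> w ! q = V1" and lt: "p < q"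
        using c' by auto
      from w show ?thesis
        using nz lt unfolding pq list.map
        by (elim disjE conjE; cases "w' ! p"; cases "w' ! q"; simp add: seen_mat_def)
    next
      case 2: False
      then obtain p where p: "c = [p]"
        using c' False by auto
      then have w: "w ! p = T0 \<or> w ! p = U1"
        using c' by auto
      from w show ?thesis
        using nz unfolding p list.map
        by (elim disjE; cases "w' ! p"; simp add: seen_mat_def)
    qed
  qed
  then show "(\<Sum>p\<leftarrow>c. weight (w' ! p)) \<le> (\<Sum>p\<leftarrow>c. weight (w ! p))"
    and "(\<Sum>p\<leftarrow>c. weight (w' ! p)) = (\<Sum>p\<leftarrow>c. weight (w ! p)) \<Longrightarrow>
      map (nth w') c = map (nth w) c \<or> (\<Sum>p\<leftarrow>c. p * letter_rank (w' ! p)) < (\<Sum>p\<leftarrow>c. p * letter_rank (w ! p))"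
    by blast+
qed

lemma foldl_alt_ad_nonzero:
  assumes "foldl (alt_ad mat2_bracket) y ds \<noteq> 0" "d \<in> set ds"
  shows "\<exists>z. alt_ad mat2_bracket z d \<noteq> 0"
proof -
  obtain xs ys where "ds = xs @ d # ys"
    using assms(2) split_list by metis
  then show ?thesis
    using assms(1)
    by (intro exI[of _ "foldl (alt_ad mat2_bracket) y xs"]) (auto simp: mat2.foldl_alt_ad_0)
qed

lemma sum_list_concat: "sum_list (map f (concat cs)) = (\<Sum>c\<leftarrow>cs. sum_list (map f c))"
  by (induction cs) simp_all

lemma sum_list_columns:
  fixes f :: "nat \<Rightarrow> 'b::comm_monoid_add"
  assumes "mset (concat cs) = mset [0..<m]"
  shows "(\<Sum>c\<leftarrow>cs. sum_list (map f c)) = sum_list (map f [0..<m])"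
  unfolding sum_list_concat[symmetric] using assms by (metis mset_map sum_mset_sum_list)

lemma sum_list_strict_mono_ex1:
  fixes f g :: "'b \<Rightarrow> 'c::ordered_cancel_comm_monoid_add"
  assumes "\<And>x. x \<in> set xs \<Longrightarrow> f x \<le> g x" "x \<in> set xs" "f x < g x"
  shows "sum_list (map f xs) < sum_list (map g xs)"
proof -
  obtain ys zs where xs: "xs = ys @ x # zs"
    using assms(2) split_list by metis
  have "sum_list (map f ys) \<le> sum_list (map g ys)" "sum_list (map f zs) \<le> sum_list (map g zs)"
    using assms(1) xs by (auto intro!: sum_list_mono)
  then show ?thesis
    using assms(3) by (simp add: xs add_le_less_mono add_less_le_mono)
qed

text \<open>If the value is nonzero, no column gains weight. As the total weights agree, every
  column keeps its weight, so its letters are merely permuted and the potential drops unless nothing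
  moves.\<close>

lemma eval_column_poly_triangular:
  assumes len: "length w' = length w" and cs: "mset (concat cs) = mset [0..<length w]"
    and col: "\<And>c. c \<in> set cs \<Longrightarrow> is_column w c"
    and wt: "sum_list (map weight w') = sum_list (map weight w)"
    and nz: "fst (mat2_pair.eval (word_subst (w' @ [T0])) (column_poly w cs :: ('a::field, nat \<times> 2) free_lie)) \<noteq> 0"
  shows "w' = w \<or> potential w' < potential w"
proof -
  let ?W = "\<lambda>w c. \<Sum>p\<leftarrow>c. weight (w ! p)" and ?P = "\<lambda>w c. \<Sum>p\<leftarrow>c. p * letter_rank (w ! p)"
  have ex: "\<exists>z :: 'a mat2. alt_ad mat2_bracket z (map (\<lambda>p. seen_mat (w ! p) (w' ! p)) c) \<noteq> 0"
    if "c \<in> set cs" for c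
    by (rule foldl_alt_ad_nonzero[OF nz[unfolded eval_column_poly[OF len cs]]]) (use that in simp)
  have le: "?W w' c \<le> ?W w c" if "c \<in> set cs" for c
    using ex[OF that] column_nonzero(1)[OF col[OF that]] by blast
  have "(\<Sum>c\<leftarrow>cs. ?W v c) = sum_list (map weight v)" if "length v = length w" for v
    using that sum_list_columns[OF cs, of "\<lambda>p. weight (v ! p)"] map_nth[of v]
    by (metis (no_types, lifting) list.map_comp comp_apply map_eq_conv)
  then have "(\<Sum>c\<leftarrow>cs. ?W w' c) = (\<Sum>c\<leftarrow>cs. ?W w c)"
    using len wt by simp
  \<comment> \<open>Equal totals leave no room for a column whose weight drops.\<close>
  then have eq: "?W w' c = ?W w c" if "c \<in> set cs" for c
    using sum_list_strict_mono_ex1[of cs "?W w'" "?W w", OF le that] le[OF that] by force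
  have alt: "map (nth w') c = map (nth w) c \<or> ?P w' c < ?P w c" if "c \<in> set cs" for c
    using ex[OF that] column_nonzero(2)[OF col[OF that]] eq[OF that] by blast
  have pot: "potential v = (\<Sum>c\<leftarrow>cs. ?P v c)" if "length v = length w" for v
    unfolding potential_def that using sum_list_columns[OF cs, of "\<lambda>p. p * letter_rank (v ! p)"] by simp
  have "?P w' c \<le> ?P w c" if "c \<in> set cs" for c
  proof -
    have "?P w' c = ?P w c" if "map (nth w') c = map (nth w) c"
      using that by (intro arg_cong[of _ _ sum_list]) auto
    then show ?thesis using alt[OF that] by linarith
  qed
  note leP = this
  show ?thesis
  proof (cases "\<exists>c\<in>set cs. ?P w' c < ?P w c")
    case True
    then show ?thesis
      using sum_list_strict_mono_ex1[of cs "?P w'" "?P w", OF leP] pot len by auto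
  next
    case False
    have "w' ! p = w ! p" if "p < length w" for p
    proof -
      have "p \<in> set (concat cs)"
        unfolding mset_eq_setD[OF cs] using that by simp
      then obtain c where c: "c \<in> set cs" "p \<in> set c"
        by auto
      then have "map (nth w') c = map (nth w) c"
        using alt[OF c(1)] False by blast
      then show ?thesis using c(2) by simp
    qed
    then show ?thesis using len by (intro disjI1 nth_equalityI) auto
  qed
qed


section \<open>Nonzero diagonal entries\<close>

definition is_multiple_t :: "'a::field_char_0 mat2 \<Rightarrow> bool" where
  "is_multiple_t z \<longleftrightarrow> z $ 1 $ 2 \<noteq> 0 \<and> z $ 1 $ 1 = 0 \<and> z $ 2 $ 1 = 0 \<and> z $ 2 $ 2 = 0"

text \<open>On multiples of \<open>t_elt\<close> the four operations are multiplication by -2, -8,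
  -4 and 8, all nonzero in characteristic 0.\<close>

lemma is_multiple_t_alt_ad:
  assumes "is_multiple_t z"
  shows "is_multiple_t (alt_ad mat2_bracket z [u_elt])"
    and "is_multiple_t (alt_ad mat2_bracket z [t_elt, u_elt, v_elt])"
    and "is_multiple_t (alt_ad mat2_bracket (alt_ad mat2_bracket z [u_elt, v_elt]) [t_elt])"
    and "is_multiple_t (alt_ad mat2_bracket (alt_ad mat2_bracket z [u_elt, v_elt]) [t_elt, u_elt])"
  using assms by (simp_all add: is_multiple_t_def mat2_bracket_nth elt_defs)

text \<open>Starting from \<open>t\<close>, each column \<open>[U1, V1]\<close> lowers the weight by one, which the next column
  \<open>[T0]\<close> or \<open>[T0, U0]\<close> undoes.\<close>

definition arrange_columns :: "'c list \<Rightarrow> 'c list \<Rightarrow> 'c list \<Rightarrow> 'c list \<Rightarrow> 'c list" where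
  "arrange_columns Us Vs Ts Ds = Us @ concat (map2 (\<lambda>v t. [v, t]) Vs Ts) @ Ds"

lemma mset_concat_interleave:
  "length Vs = length Ts \<Longrightarrow>
    mset (concat (concat (map2 (\<lambda>v t. [v, t]) Vs Ts))) = mset (concat Vs) + mset (concat Ts)"
  by (induction Vs Ts rule: list_induct2) simp_all

lemma foldl_arrange_columns:
  assumes len: "length Vs = length Ts"
    and Us: "\<And>c. c \<in> set Us \<Longrightarrow> map g c = [u_elt]"
    and Vs: "\<And>c. c \<in> set Vs \<Longrightarrow> map g c = [u_elt, v_elt]"
    and Ts: "\<And>c. c \<in> set Ts \<Longrightarrow> map g c = [t_elt] \<or> map g c = [t_elt, u_elt]"
    and Ds: "\<And>c. c \<in> set Ds \<Longrightarrow> map g c = [t_elt, u_elt, v_elt]"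
  shows "is_multiple_t (foldl (alt_ad mat2_bracket) t_elt (map (map g) (arrange_columns Us Vs Ts Ds)))"
proof -
  have 1: "is_multiple_t (foldl (alt_ad mat2_bracket) z (map (map g) Us))" if "is_multiple_t z" for z
    using that Us by (induction Us arbitrary: z) (simp_all add: is_multiple_t_alt_ad del: alt_ad.simps)
  have 2: "is_multiple_t (foldl (alt_ad mat2_bracket) z (map (map g) (concat (map2 (\<lambda>v t. [v, t]) Vs Ts))))"
    if "is_multiple_t z" for z
    using len that Vs Ts
  proof (induction Vs Ts arbitrary: z rule: list_induct2)
    case (Cons v Vs t Ts)
    have "is_multiple_t (alt_ad mat2_bracket (alt_ad mat2_bracket z (map g v)) (map g t))"
      using Cons.prems(2)[of v] Cons.prems(3)[of t] Cons.prems(1)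
      by (auto simp: is_multiple_t_alt_ad simp del: alt_ad.simps)
    from Cons.IH[OF this] Cons.prems(2,3) show ?case by simp
  qed simp
  have 3: "is_multiple_t (foldl (alt_ad mat2_bracket) z (map (map g) Ds))" if "is_multiple_t z" for z
    using that Ds by (induction Ds arbitrary: z) (simp_all add: is_multiple_t_alt_ad del: alt_ad.simps)
  have "is_multiple_t t_elt"
    by (simp add: is_multiple_t_def elt_defs)
  then show ?thesis
    unfolding arrange_columns_def map_append foldl_append by (intro 1 2 3)
qed

section \<open>Ballot words and their columns\<close>

definition dominates :: "letter \<Rightarrow> letter \<Rightarrow> letter list \<Rightarrow> bool" where
  "dominates a b w \<longleftrightarrow> (\<forall>k. count_list (take k w) b \<le> count_list (take k w) a)"

lemma dominates_count: "dominates a b w \<Longrightarrow> count_list w b \<le> count_list w a"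
  unfolding dominates_def by (metis order_refl take_all)

lemma dominates_butlast: "dominates a b (w @ v) \<Longrightarrow> dominates a b w"
  unfolding dominates_def
proof
  fix k assume "\<forall>k. count_list (take k (w @ v)) b \<le> count_list (take k (w @ v)) a"
  from spec[OF this, of "min k (length w)"] show "count_list (take k w) b \<le> count_list (take k w) a"
    by (simp add: min_def split: if_splits)
qed

text \<open>Bounding the positions by the length keeps the pattern intact when letters are appended
  to the word.\<close>

definition has_pattern :: "letter list \<Rightarrow> letter list \<Rightarrow> nat list \<Rightarrow> bool" where
  "has_pattern w a c \<longleftrightarrow> set c \<subseteq> {..<length w} \<and> sorted_wrt (<) c \<and> map (nth w) c = a"

lemma has_pattern_snoc: "has_pattern w a c \<Longrightarrow> has_pattern (w @ [x]) a c"
  by (auto simp: has_pattern_def nth_append)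

lemma has_pattern_extend: "has_pattern w a c \<Longrightarrow> has_pattern (w @ [x]) (a @ [x]) (c @ [length w])"
  by (auto simp: has_pattern_def nth_append sorted_wrt_append)

text \<open>The word is read from left to right, as when a standard tableau is filled:
  \<open>T0\<close> and \<open>U1\<close> open a column, and every other letter extends a column
  that ends in its predecessor. The length equations are the invariant that guarantees such a
  column.\<close>

lemma columns_exist:
  assumes "dominates T0 U0 w" "dominates U0 V0 w" "dominates U1 V1 w"
  shows "\<exists>A1 A2 A3 B1 B2. mset (concat (A1 @ A2 @ A3 @ B1 @ B2)) = mset [0..<length w] \<and>
    (\<forall>c\<in>set A1. has_pattern w [T0] c) \<and> (\<forall>c\<in>set A2. has_pattern w [T0, U0] c) \<and>
    (\<forall>c\<in>set A3. has_pattern w [T0, U0, V0] c) \<and>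
    (\<forall>c\<in>set B1. has_pattern w [U1] c) \<and> (\<forall>c\<in>set B2. has_pattern w [U1, V1] c) \<and>
    length A1 + count_list w U0 = count_list w T0 \<and> length A2 + count_list w V0 = count_list w U0 \<and>
    length A3 = count_list w V0 \<and>
    length B1 + count_list w V1 = count_list w U1 \<and> length B2 = count_list w V1"
  using assms
proof (induction w rule: rev_induct)
  case Nil
  show ?case by (intro exI[of _ "[]"]) simp
next
  case (snoc x w)
  obtain A1 A2 A3 B1 B2 where
    m: "mset (concat (A1 @ A2 @ A3 @ B1 @ B2)) = mset [0..<length w]" and
    p: "\<forall>c\<in>set A1. has_pattern w [T0] c" "\<forall>c\<in>set A2. has_pattern w [T0, U0] c"
    "\<forall>c\<in>set A3. has_pattern w [T0, U0, V0] c"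
    "\<forall>c\<in>set B1. has_pattern w [U1] c" "\<forall>c\<in>set B2. has_pattern w [U1, V1] c" and
    l: "length A1 + count_list w U0 = count_list w T0" "length A2 + count_list w V0 = count_list w U0"
    "length A3 = count_list w V0"
    "length B1 + count_list w V1 = count_list w U1" "length B2 = count_list w V1"
    using snoc.IH[OF snoc.prems[THEN dominates_butlast]] by blast
  note p' = p[THEN bspec, THEN has_pattern_snoc[of _ _ _ x]]
  note cnt = snoc.prems[THEN dominates_count]
  have single: "has_pattern (w @ [x]) [x] [length w]"
    by (simp add: has_pattern_def)
  show ?case
  proof (cases x)
    case T0
    show ?thesis
      by (rule exI[of _ "[length w] # A1"], rule exI[of _ A2], rule exI[of _ A3], rule exI[of _ B1],
          rule exI[of _ B2]) (use m l p' single T0 in auto)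
  next
    case U1
    show ?thesis
      by (rule exI[of _ A1], rule exI[of _ A2], rule exI[of _ A3], rule exI[of _ "[length w] # B1"],
          rule exI[of _ B2]) (use m l p' single U1 in auto)
  next
    case U0
    \<comment> \<open>Domination holds for the word including the new \<open>U0\<close>, so the old
      word has strictly more \<open>T0\<close> than \<open>U0\<close>.\<close>
    then have "A1 \<noteq> []" using l(1) cnt(1) by auto
    then obtain c C where A: "A1 = c # C" by (cases A1) auto
    have np: "has_pattern (w @ [x]) [T0, U0] (c @ [length w])"
      using has_pattern_extend[of w "[T0]" c x] p(1) A U0 by simp
    show ?thesis
      by (rule exI[of _ C], rule exI[of _ "(c @ [length w]) # A2"], rule exI[of _ A3], rule exI[of _ B1], rule exI[of _ B2])
        (use m l p' np U0 A in \<open>auto simp: ac_simps\<close>)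
  next
    case V0
    then have "A2 \<noteq> []" using l(2) cnt(2) by auto
    then obtain c C where A: "A2 = c # C" by (cases A2) auto
    have np: "has_pattern (w @ [x]) [T0, U0, V0] (c @ [length w])"
      using has_pattern_extend[of w "[T0, U0]" c x] p(2) A V0 by simp
    show ?thesis
      by (rule exI[of _ A1], rule exI[of _ C], rule exI[of _ "(c @ [length w]) # A3"], rule exI[of _ B1], rule exI[of _ B2])
        (use m l p' np V0 A in \<open>auto simp: ac_simps\<close>)
  next
    case V1
    then have "B1 \<noteq> []" using l(4) cnt(3) by auto
    then obtain c C where B: "B1 = c # C" by (cases B1) auto
    have np: "has_pattern (w @ [x]) [U1, V1] (c @ [length w])"
      using has_pattern_extend[of w "[U1]" c x] p(4) B V1 by simp
    show ?thesis
      by (rule exI[of _ A1], rule exI[of _ A2], rule exI[of _ A3], rule exI[of _ C], rule exI[of _ "(c @ [length w]) # B2"])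
        (use m l p' np V1 B in \<open>auto simp: ac_simps\<close>)
  qed
qed

definition ballot_words :: "nat \<Rightarrow> letter list set" where
  "ballot_words m = {w. length w = m \<and> dominates T0 U0 w \<and> dominates U0 V0 w \<and> dominates U1 V1 w \<and>
     count_list w T0 = count_list w V0 + count_list w V1}"

lemma sum_list_weight: "sum_list (map weight w) = int (count_list w T0) - int (count_list w V0) - int (count_list w V1)"
proof (induction w)
  case (Cons a w)
  then show ?case by (cases a) simp_all
qed simp

lemma ballot_word_columns:
  assumes "w \<in> ballot_words m"
  shows "\<exists>cs. mset (concat cs) = mset [0..<length w] \<and> (\<forall>c\<in>set cs. is_column w c) \<and>
    is_multiple_t (fst (mat2_pair.eval (word_subst (w @ [T0])) (column_poly w cs
      :: ('a::field_char_0, nat \<times> 2) free_lie)))"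
proof -
  obtain A1 A2 A3 B1 B2 where
    m: "mset (concat (A1 @ A2 @ A3 @ B1 @ B2)) = mset [0..<length w]" and
    p: "\<forall>c\<in>set A1. has_pattern w [T0] c" "\<forall>c\<in>set A2. has_pattern w [T0, U0] c"
    "\<forall>c\<in>set A3. has_pattern w [T0, U0, V0] c"
    "\<forall>c\<in>set B1. has_pattern w [U1] c" "\<forall>c\<in>set B2. has_pattern w [U1, V1] c" and
    l: "length A1 + count_list w U0 = count_list w T0" "length A2 + count_list w V0 = count_list w U0"
    "length A3 = count_list w V0"
    "length B1 + count_list w V1 = count_list w U1" "length B2 = count_list w V1"
    using columns_exist[of w] assms unfolding ballot_words_def by blast
  let ?cs = "arrange_columns B1 B2 (A1 @ A2) A3"
  \<comment> \<open>Weight zero means that the columns \<open>[U1, V1]\<close> are as many as the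
    columns \<open>[T0]\<close> and \<open>[T0, U0]\<close> together, so they can be paired.\<close>
  have len: "length B2 = length (A1 @ A2)"
    using l assms by (simp add: ballot_words_def)
  have ms: "mset (concat ?cs) = mset [0..<length w]"
    using m mset_concat_interleave[OF len] by (simp add: arrange_columns_def ac_simps)
  have "set ?cs \<subseteq> set (B1 @ B2 @ A1 @ A2 @ A3)"
    by (auto simp: arrange_columns_def dest: set_zip_leftD set_zip_rightD)
  then have "is_column w c" if "c \<in> set ?cs" for c
    using that p by (auto simp: is_column_def column_patterns_def has_pattern_def)
  moreover have "is_multiple_t (foldl (alt_ad mat2_bracket) t_elt
      (map (map (\<lambda>p. seen_mat (w ! p) (w ! p))) ?cs) :: 'a mat2)"
  proof (rule foldl_arrange_columns[OF len])
    have g: "map (\<lambda>p. seen_mat (w ! p) (w ! p)) c = map letter_mat a" if "has_pattern w a c" for a c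
      using that by (auto simp: has_pattern_def seen_mat_def)
    show "map (\<lambda>p. seen_mat (w ! p) (w ! p)) c = [u_elt]" if "c \<in> set B1" for c
      using p(4) that g[of "[U1]" c] by simp
    show "map (\<lambda>p. seen_mat (w ! p) (w ! p)) c = [u_elt, v_elt]" if "c \<in> set B2" for c
      using p(5) that g[of "[U1, V1]" c] by simp
    show "map (\<lambda>p. seen_mat (w ! p) (w ! p)) c = [t_elt] \<or>
        map (\<lambda>p. seen_mat (w ! p) (w ! p)) c = [t_elt, u_elt]" if "c \<in> set (A1 @ A2)" for c
      using p(1,2) that g[of "[T0]" c] g[of "[T0, U0]" c] by auto
    show "map (\<lambda>p. seen_mat (w ! p) (w ! p)) c = [t_elt, u_elt, v_elt]" if "c \<in> set A3" for c
      using p(3) that g[of "[T0, U0, V0]" c] by simp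
  qed
  ultimately show ?thesis
    using ms by (intro exI[of _ ?cs] conjI ballI) (simp_all only: eval_column_poly[OF HOL.refl ms])
qed

text \<open>Column polynomials of distinct ballot words are independent modulo the identities:
  evaluating a dependence at the word of largest potential among those with nonzero coefficient
  leaves only its diagonal entry. The innermost variable accounts for \<open>Suc m\<close>.\<close>

lemma graded_codim_ge:
  "card (ballot_words m) \<le> mat2_pair.graded_codim (L_comp :: 2 \<Rightarrow> ('a::field_char_0 mat2 \<times> 'a mat2) set) (Suc m)"
proof -
  let ?V = "multilinear_part (Suc m) :: ('a, nat \<times> 2) free_lie set"
  let ?I = "?V \<inter> mat2_pair.graded_identities L_comp"
  let ?e = "\<lambda>w f. fst (mat2_pair.eval (word_subst (w @ [T0])) f) :: 'a mat2"
  have fin: "finite (ballot_words m)"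
    by (rule finite_subset[OF _ finite_words[of m]]) (auto simp: ballot_words_def)
  have "\<forall>w\<in>ballot_words m. \<exists>cs. mset (concat cs) = mset [0..<length w] \<and> (\<forall>c\<in>set cs. is_column w c) \<and>
      is_multiple_t (?e w (column_poly w cs))"
    using ballot_word_columns by blast
  then obtain cs where cs: "\<And>w. w \<in> ballot_words m \<Longrightarrow> mset (concat (cs w)) = mset [0..<length w]"
      "\<And>w c. w \<in> ballot_words m \<Longrightarrow> c \<in> set (cs w) \<Longrightarrow> is_column w c"
      "\<And>w. w \<in> ballot_words m \<Longrightarrow> is_multiple_t (?e w (column_poly w (cs w)))"
    by (metis (no_types, lifting))
  let ?f = "\<lambda>w. column_poly w (cs w) :: ('a, nat \<times> 2) free_lie"
  have fV: "?f w \<in> ?V" if "w \<in> ballot_words m" for w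
    using column_poly_multilinear[OF cs(1)[OF that]] that by (simp add: ballot_words_def)
  have wt: "sum_list (map weight w) = 0" if "w \<in> ballot_words m" for w
    using that by (simp add: sum_list_weight ballot_words_def)
  have e_lin: "?e w (\<Sum>v\<in>A. free_scale (c v) (?f v)) = (\<Sum>v\<in>A. mat2_scale (c v) (?e w (?f v)))" for w c A
    by (induction A rule: infinite_finite_induct) simp_all
  have "c w = 0" if s: "(\<Sum>v\<in>ballot_words m. free_scale (c v) (?f v)) \<in> ?I" and w: "w \<in> ballot_words m" for c w
  proof (rule ccontr)
    assume "c w \<noteq> 0"
    let ?S = "{v \<in> ballot_words m. c v \<noteq> 0}"
    have "finite ?S" "?S \<noteq> {}"
      using fin w \<open>c w \<noteq> 0\<close> by auto
    then obtain x where x: "x \<in> ?S" and max: "\<And>v. v \<in> ?S \<Longrightarrow> potential v \<le> potential x"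
      using Max_in[of "potential ` ?S"] Max_ge[of "potential ` ?S"] by fastforce
    have "mat2_scale (c v) (?e x (?f v)) = 0" if v: "v \<in> ballot_words m" "v \<noteq> x" for v
    proof (cases "c v = 0")
      case False
      have "?e x (?f v) = 0"
        using eval_column_poly_triangular[of x v "cs v"] cs(1,2)[OF v(1)] x v wt max[of v] False
        by (force simp: ballot_words_def)
      then show ?thesis by simp
    qed simp
    then have "(\<Sum>v\<in>ballot_words m - {x}. mat2_scale (c v) (?e x (?f v))) = 0"
      by (intro sum.neutral) blast
    then have "(\<Sum>v\<in>ballot_words m. mat2_scale (c v) (?e x (?f v))) = mat2_scale (c x) (?e x (?f x))"
      using x fin by (subst sum.remove[of _ x]) simp_all
    moreover have "?e x (\<Sum>v\<in>ballot_words m. free_scale (c v) (?f v)) = 0"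
      using s unfolding mat2_pair.graded_identities_def by (simp add: word_subst_in_L_comp)
    ultimately have "mat2_scale (c x) (?e x (?f x)) = 0"
      unfolding e_lin by simp
    then show False
      using cs(3)[of x] x by (auto simp: is_multiple_t_def mat2_eq_iff)
  qed
  then have ind: "free_lie.independent_mod ?I (ballot_words m) ?f"
    unfolding free_lie.independent_mod_def by blast
  obtain T where T: "finite T" "?V \<subseteq> free_lie.span T"
    using multilinear_part_span_finite by blast
  have img: "?f ` ballot_words m \<subseteq> ?V"
    using fV by (rule image_subsetI)
  show ?thesis
    unfolding mat2_pair.graded_codim_def
    by (rule free_lie.quotient_dim_ge[OF multilinear_identities_subspace Int_lower1
          multilinear_part_subspace T(2,1) fin img ind])
qed

section \<open>Counting ballot words\<close>

definition slack_dominates :: "nat \<Rightarrow> 'a \<Rightarrow> 'a \<Rightarrow> 'a list \<Rightarrow> bool" where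
  "slack_dominates s a b w \<longleftrightarrow> (\<forall>k. count_list (take k w) b \<le> s + count_list (take k w) a)"

text \<open>The initial slack and the surplus of \<open>a\<close> over \<open>b\<close> in
  \<open>v\<close> together pay for the slack \<open>s'\<close> that \<open>w\<close> needs.\<close>

lemma slack_dominates_append:
  assumes "slack_dominates s a b v" "slack_dominates s' a b w" "s' + count_list v b \<le> s + count_list v a"
  shows "slack_dominates s a b (v @ w)"
  unfolding slack_dominates_def
proof
  fix k
  show "count_list (take k (v @ w)) b \<le> s + count_list (take k (v @ w)) a"
  proof (cases "k \<le> length v")
    case True
    then show ?thesis using assms(1) by (simp add: slack_dominates_def)
  next
    case False
    then show ?thesis
      using assms(3) assms(2)[unfolded slack_dominates_def, rule_format, of "k - length v"] by simp
  qed
qed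

lemma count_list_take_le: "count_list (take k w) b \<le> count_list w b"
proof -
  have "count_list w b = count_list (take k w) b + count_list (drop k w) b"
    by (metis append_take_drop_id count_list_append)
  then show ?thesis by simp
qed

lemma slack_dominates_if_count_le: "count_list w b \<le> s \<Longrightarrow> slack_dominates s a b w"
  unfolding slack_dominates_def using count_list_take_le[of _ w b] by (meson le_trans trans_le_add1)

text \<open>Inside a block the deficit is at most the number of its letters \<open>b\<close>, and
  each complete block ends without a new deficit.\<close>

lemma slack_dominates_concat:
  assumes "\<And>v. v \<in> set vs \<Longrightarrow> count_list v b \<le> s \<and> count_list v b \<le> count_list v a"
  shows "slack_dominates s a b (concat vs)"
  using assms
proof (induction vs)
  case Nil
  then show ?case by (simp add: slack_dominates_def)
next
  case (Cons v vs)
  then have "slack_dominates s a b (v @ concat vs)"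
    by (intro slack_dominates_append[OF slack_dominates_if_count_le, where s' = s]) auto
  then show ?case by simp
qed

lemma count_list_concat_const:
  "(\<And>v. v \<in> set vs \<Longrightarrow> count_list v b = c) \<Longrightarrow> count_list (concat vs) b = length vs * c"
  by (induction vs) simp_all

text \<open>For \<open>k\<close> close to sqrt 2 * \<open>m\<close> the letter frequencies approach
  the optimal ratio, and the block has weight zero for every \<open>k\<close>.\<close>

definition block_mset :: "nat \<Rightarrow> nat \<Rightarrow> letter multiset" where
  "block_mset m k = replicate_mset (2 * m) T0 + replicate_mset k U0 + replicate_mset m V0
     + replicate_mset k U1 + replicate_mset m V1"

text \<open>The prefix absorbs the imbalance inside a single block, and the letters \<open>V1\<close> at the end restore
  weight zero; the final letters \<open>U1\<close> only adjust the length.\<close>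

definition padded_word :: "nat \<Rightarrow> nat \<Rightarrow> letter list list \<Rightarrow> letter list" where
  "padded_word r j bs = replicate (2 * r) T0 @ replicate r U0 @ replicate (3 * r) U1
     @ concat bs @ replicate (2 * r) V1 @ replicate j U1"

lemma count_list_replicate: "count_list (replicate n x) y = (if x = y then n else 0)"
  by (induction n) auto

text \<open>\<open>r\<close> is the length of a block and bounds each letter count in it. Before the
  blocks the surplus is \<open>r\<close> for \<open>T0\<close> over \<open>U0\<close> and for
  \<open>U0\<close> over \<open>V0\<close>, and \<open>3 * r\<close> for \<open>U1\<close> over
  \<open>V1\<close>, of which \<open>2 * r\<close> are kept for the closing letters
  \<open>V1\<close>. By the bounds on \<open>k\<close> complete blocks never lower a
  surplus.\<close>

lemma padded_word_ballot:
  assumes mk: "m \<le> k" "k \<le> 2 * m" and r: "r = 4 * m + 2 * k"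
    and bs: "\<And>b. b \<in> set bs \<Longrightarrow> mset b = block_mset m k"
  shows "padded_word r j bs \<in> ballot_words ((8 + length bs) * r + j)"
proof -
  have cnt: "count_list b T0 = 2 * m" "count_list b U0 = k" "count_list b V0 = m"
    "count_list b U1 = k" "count_list b V1 = m" if "b \<in> set bs" for b
    using bs[OF that] by (simp_all add: block_mset_def flip: count_mset)
  have len: "length b = r" if "b \<in> set bs" for b
    using arg_cong[OF bs[OF that], of size] r by (simp add: block_mset_def)
  have mono: "length bs * m \<le> c + length bs * k" "length bs * m \<le> c + (d + length bs * k)"
    "length bs * k \<le> c + length bs * (2 * m)" for c d
    using mk by (intro trans_le_add2 mult_le_mono2; simp)+
  have "length (concat bs) = length bs * r"
    using len by (induction bs) simp_all
  then have "length (padded_word r j bs) = (8 + length bs) * r + j"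
    by (simp add: padded_word_def algebra_simps)
  moreover have "slack_dominates 0 T0 U0 (padded_word r j bs)"
    unfolding padded_word_def
    \<comment> \<open>Each \<open>s'\<close> is a surplus of \<open>T0\<close> over
      \<open>U0\<close> that is guaranteed when the next segment starts.\<close>
    by (rule slack_dominates_append[where s' = "2 * r"], simp add: slack_dominates_if_count_le count_list_replicate,
        rule slack_dominates_append[where s' = r], simp add: slack_dominates_if_count_le count_list_replicate,
        rule slack_dominates_append[where s' = r], simp add: slack_dominates_if_count_le count_list_replicate,
        rule slack_dominates_append[where s' = 0], rule slack_dominates_concat)
      (use mk r cnt in \<open>auto simp: mono slack_dominates_if_count_le count_list_replicate count_list_concat_const[where c = k]
         count_list_concat_const[where c = "2 * m"]\<close>)
  moreover have "slack_dominates 0 U0 V0 (padded_word r j bs)"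
    unfolding padded_word_def
    by (rule slack_dominates_append[where s' = 0], simp add: slack_dominates_if_count_le count_list_replicate,
        rule slack_dominates_append[where s' = r], simp add: slack_dominates_if_count_le count_list_replicate,
        rule slack_dominates_append[where s' = r], simp add: slack_dominates_if_count_le count_list_replicate,
        rule slack_dominates_append[where s' = 0], rule slack_dominates_concat)
      (use mk r cnt in \<open>auto simp: mono slack_dominates_if_count_le count_list_replicate count_list_concat_const[where c = k]
         count_list_concat_const[where c = m]\<close>)
  moreover have "slack_dominates 0 U1 V1 (padded_word r j bs)"
    unfolding padded_word_def
    by (rule slack_dominates_append[where s' = 0], simp add: slack_dominates_if_count_le count_list_replicate,
        rule slack_dominates_append[where s' = 0], simp add: slack_dominates_if_count_le count_list_replicate,
        rule slack_dominates_append[where s' = "3 * r"], simp add: slack_dominates_if_count_le count_list_replicate,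
        rule slack_dominates_append[where s' = "2 * r"], rule slack_dominates_concat)
      (use mk r cnt in \<open>auto simp: mono slack_dominates_if_count_le count_list_replicate count_list_concat_const[where c = k]
         count_list_concat_const[where c = m]\<close>)
  moreover have "count_list (padded_word r j bs) T0 =
      count_list (padded_word r j bs) V0 + count_list (padded_word r j bs) V1"
    using cnt count_list_concat_const[of bs T0 "2 * m"] count_list_concat_const[of bs V0 m]
      count_list_concat_const[of bs V1 m]
    by (simp add: padded_word_def count_list_replicate)
  ultimately show ?thesis
    by (simp add: ballot_words_def dominates_def slack_dominates_def)
qed

text \<open>The padding takes eight block lengths and a remainder. The blocks have equal length, so
  their concatenation determines them and they can be chosen independently.\<close>

lemma card_ballot_words_ge:
  assumes mk: "m \<le> k" "k \<le> 2 * m" and r: "r = 4 * m + 2 * k" and M: "8 * r \<le> M" and "0 < m"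
  shows "card (permutations_of_multiset (block_mset m k)) ^ (M div r - 8) \<le> card (ballot_words M)"
proof -
  let ?P = "permutations_of_multiset (block_mset m k)" and ?N = "M div r - 8"
  let ?L = "{bs. set bs \<subseteq> ?P \<and> length bs = ?N}"
  have "8 \<le> M div r"
    using M r \<open>0 < m\<close> by (simp add: less_eq_div_iff_mult_less_eq)
  then have "(8 + ?N) * r + M mod r = M"
    by simp
  then have sub: "padded_word r (M mod r) ` ?L \<subseteq> ballot_words M"
    using padded_word_ballot[OF mk r, of _ "M mod r"] by (fastforce simp: permutations_of_multiset_def)
  have inj: "inj_on (padded_word r (M mod r)) ?L"
  proof
    fix bs bs' assume L: "bs \<in> ?L" "bs' \<in> ?L" and eq: "padded_word r (M mod r) bs = padded_word r (M mod r) bs'"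
    have zip: "length x = length y" if "(x, y) \<in> set (zip bs bs')" for x y
    proof -
      have "x \<in> ?P" "y \<in> ?P"
        using L set_zip_leftD[OF that] set_zip_rightD[OF that] by blast+
      then have "mset x = mset y"
        by (simp add: permutations_of_multisetD)
      then show ?thesis by (rule mset_eq_length)
    qed
    have len: "length bs = length bs'"
      using L by simp
    have "\<forall>(x, y)\<in>set (zip bs bs'). length x = length y"
      by (intro ballI case_prodI2) (rule zip, simp)
    from concat_eq_concat_iff[OF this len] show "bs = bs'"
      using eq by (simp add: padded_word_def)
  qed
  have fin: "finite (ballot_words M)"
    by (rule finite_subset[OF _ finite_words[of M]]) (auto simp: ballot_words_def)
  have "card ?L \<le> card (ballot_words M)"
    by (rule card_inj_on_le[OF inj sub fin])
  then show ?thesis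
    by (simp add: card_lists_length_eq)
qed

section \<open>Factorial estimates and the number of rearrangements of a block\<close>

lemma power_self_le_exp_fact: "real n ^ n \<le> exp (real n) * fact n"
proof (induction n)
  case (Suc n)
  show ?case
  proof (cases "n = 0")
    case False
    \<comment> \<open>The quotient of consecutive values of \<open>n ^ n / fact n\<close> is
      \<open>(1 + 1/n) ^ n\<close>, which is at most \<open>exp 1\<close>.\<close>
    have "(1 + 1 / real n) ^ n \<le> exp (1 / real n) ^ n"
      by (intro power_mono) (use exp_ge_add_one_self[of "1 / real n"] in simp_all)
    also have "\<dots> = exp 1"
      using False by (simp flip: exp_of_nat_mult)
    finally have 1: "(1 + 1 / real n) ^ n \<le> exp 1" .
    have "real (Suc n) ^ Suc n = real (Suc n) * ((1 + 1 / real n) ^ n * real n ^ n)"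
      using False by (simp add: field_simps flip: power_mult_distrib)
    also have "\<dots> \<le> real (Suc n) * (exp 1 * (exp (real n) * fact n))"
      by (intro mult_left_mono mult_mono 1 Suc.IH) simp_all
    also have "\<dots> = exp (real (Suc n)) * fact (Suc n)"
      by (simp add: exp_add algebra_simps)
    finally show ?thesis .
  qed simp
qed simp

text \<open>The counterpart, up to a linear factor; the inductive step rests on
  \<open>(1 - 1/(n+1)) ^ (n+1)\<close> being at most \<open>exp (-1)\<close>.\<close>

lemma exp_fact_le_power_self: "0 < n \<Longrightarrow> exp (real n) * fact n \<le> exp 1 * real n * real n ^ n"
proof (induction n rule: nat_induct_non_zero)
  case (Suc n)
  let ?m = "real (Suc n)"
  have "(real n / ?m) ^ Suc n \<le> exp (- 1 / ?m) ^ Suc n"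
    by (intro power_mono) (use exp_ge_add_one_self[of "- 1 / ?m"] in \<open>simp_all add: field_simps\<close>)
  also have "\<dots> = exp (real (Suc n) * (- 1 / ?m))"
    by (rule exp_of_nat_mult[symmetric])
  also have "\<dots> = exp (- 1)"
    by simp
  finally have "exp 1 * real n ^ Suc n \<le> ?m ^ Suc n"
    by (simp add: power_divide exp_minus field_simps del: power_Suc of_nat_Suc)
  then have 1: "exp 1 * real n * real n ^ n \<le> ?m ^ Suc n"
    by (simp add: mult.assoc)
  have "exp ?m * fact (Suc n) = ?m * exp 1 * (exp (real n) * fact n)"
    by (simp add: exp_add algebra_simps)
  also have "\<dots> \<le> ?m * exp 1 * (exp 1 * real n * real n ^ n)"
    by (intro mult_left_mono Suc.IH) simp_all
  also have "\<dots> \<le> ?m * exp 1 * ?m ^ Suc n"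
    by (intro mult_left_mono 1) simp_all
  finally show ?case by (simp add: mult_ac)
qed simp

lemma card_block_permutations:
  assumes "0 < m" "0 < k"
  shows "real (card (permutations_of_multiset (block_mset m k))) =
    fact (4 * m + 2 * k) / (fact (2 * m) * (fact k * fact k) * (fact m * fact m))"
proof -
  have set: "set_mset (block_mset m k) = {T0, U0, V0, U1, V1}"
    using assms by (auto simp: block_mset_def)
  have "size (block_mset m k) = 4 * m + 2 * k"
    by (simp add: block_mset_def)
  moreover have "(\<Prod>x\<in>set_mset (block_mset m k). fact (count (block_mset m k) x)) =
      (fact (2 * m) * (fact k * fact k) * (fact m * fact m) :: nat)"
    unfolding set by (simp add: block_mset_def)
  ultimately show ?thesis
    using card_permutations_of_multiset[of "block_mset m k"] by (simp add: real_of_nat_div)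
qed

text \<open>Up to a polynomial factor, the multinomial coefficient is bounded below by the product
  of \<open>(r / c) ^ c\<close> over the letter counts \<open>c\<close>. Each ratio
  \<open>r / c\<close> is at least \<open>?\<Lambda> * ?d\<close> divided by the
  \<open>letter_weight\<close> of the letter.\<close>

lemma card_block_permutations_ge:
  assumes m: "0 < m" and k: "k = nat \<lfloor>sqrt 2 * real m\<rfloor>" and r: "r = 4 * m + 2 * k"
  shows "((2 + 2 * sqrt 2) * (1 - 1 / (sqrt 2 * real m))) ^ r \<le>
    exp 5 * real r ^ 5 * real (card (permutations_of_multiset (block_mset m k)))"
proof -
  let ?\<Lambda> = "2 + 2 * sqrt 2 :: real" and ?d = "1 - 1 / (sqrt 2 * real m)"
  have s: "1 \<le> sqrt 2" "sqrt 2 * sqrt 2 = 2" by simp_all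
  have "1 \<le> sqrt 2 * real m"
    using m s(1) mult_mono[of 1 "sqrt 2" 1 "real m"] by simp
  then have kp: "0 < k" and kle: "real k \<le> sqrt 2 * real m" and kge: "sqrt 2 * real m - 1 \<le> real k"
    unfolding k by linarith+
  have d0: "0 \<le> ?d"
    using \<open>1 \<le> sqrt 2 * real m\<close> m by (simp add: field_simps)
  \<comment> \<open>The factor \<open>?d\<close> pays for rounding down to \<open>k\<close>: with
    \<open>k\<close> equal to sqrt 2 * \<open>m\<close> and \<open>?d\<close> equal to 1, the bound
    \<open>rge\<close> would be an equality.\<close>
  have "?\<Lambda> * ?d * (sqrt 2 * real m) = ?\<Lambda> * (sqrt 2 * real m - 1)"
    using m by (simp add: field_simps)
  also have "\<dots> = 4 * real m + 2 * (sqrt 2 * real m) - 2 - 2 * sqrt 2"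
    by (simp add: algebra_simps)
  also have "\<dots> \<le> 4 * real m + 2 * real k"
    using kge s(1) by linarith
  also have "\<dots> = real r"
    using r by simp
  finally have rge: "?\<Lambda> * ?d * (sqrt 2 * real m) \<le> real r" .
  have X0: "0 \<le> ?\<Lambda> * ?d"
    using d0 by simp
  have "x / sqrt 2 = x * (sqrt 2 * real m) / real (2 * m)" for x
    using m by (simp add: field_simps)
  then have "?\<Lambda> * ?d / sqrt 2 = ?\<Lambda> * ?d * (sqrt 2 * real m) / real (2 * m)"
    by blast
  also have "\<dots> \<le> real r / real (2 * m)"
    by (rule divide_right_mono[OF rge]) simp
  finally have t: "?\<Lambda> * ?d / sqrt 2 \<le> real r / real (2 * m)" .
  have u: "?\<Lambda> * ?d \<le> real r / real k"
    using order_trans[OF mult_left_mono[OF kle X0] rge] kp by (simp add: field_simps)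
  have v: "?\<Lambda> * ?d * sqrt 2 \<le> real r / real m"
    using rge m by (simp add: field_simps)
  \<comment> \<open>The powers of \<open>sqrt 2\<close> cancel because a block has weight
    zero.\<close>
  have "(?\<Lambda> * ?d) ^ r = (?\<Lambda> * ?d / sqrt 2) ^ (2 * m) * ((?\<Lambda> * ?d) ^ k * (?\<Lambda> * ?d) ^ k)
      * ((?\<Lambda> * ?d * sqrt 2) ^ m * (?\<Lambda> * ?d * sqrt 2) ^ m)"
  proof -
    have "sqrt 2 ^ (2 * m) = sqrt 2 ^ m * (sqrt 2 ^ m :: real)"
      by (simp add: mult_2 power_add)
    moreover have "r = 2 * m + (k + k) + (m + m)"
      using r by simp
    ultimately show ?thesis
      by (simp only: power_mult_distrib power_divide power_add) (simp add: mult_ac)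
  qed
  also have "\<dots> \<le> (real r / real (2 * m)) ^ (2 * m) * ((real r / real k) ^ k * (real r / real k) ^ k)
      * ((real r / real m) ^ m * (real r / real m) ^ m)"
    using X0 by (intro mult_mono power_mono t u v) simp_all
  finally have main: "(?\<Lambda> * ?d) ^ r \<le> \<dots>" .
  let ?D = "real (2 * m) ^ (2 * m) * (real k ^ k * real k ^ k) * (real m ^ m * real m ^ m)"
  have "(real r / real (2 * m)) ^ (2 * m) * ((real r / real k) ^ k * (real r / real k) ^ k)
      * ((real r / real m) ^ m * (real r / real m) ^ m) = real r ^ r / ?D"
  proof -
    have "r = 2 * m + (k + k) + (m + m)"
      using r by simp
    then have "real r ^ r = real r ^ (2 * m) * (real r ^ k * real r ^ k) * (real r ^ m * real r ^ m)"
      by (metis power_add)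
    then show ?thesis by (simp only: power_divide times_divide_times_eq)
  qed
  with main have main': "(?\<Lambda> * ?d) ^ r * ?D \<le> real r ^ r"
    using m kp by (simp add: pos_le_divide_eq)
  let ?F = "fact (2 * m) * (fact k * fact k) * (fact m * fact m) :: real"
  let ?c = "real (2 * m) * (real k * real k) * (real m * real m)"
  have "exp (real r) * ?F = (exp (real (2 * m)) * fact (2 * m)) *
      ((exp (real k) * fact k) * (exp (real k) * fact k)) * ((exp (real m) * fact m) * (exp (real m) * fact m))"
  proof -
    have "real r = real (2 * m) + (real k + real k) + (real m + real m)"
      using r by simp
    then show ?thesis by (simp only: exp_add) (simp only: mult_ac)
  qed
  also have "\<dots> \<le> (exp 1 * real (2 * m) * real (2 * m) ^ (2 * m)) *
      ((exp 1 * real k * real k ^ k) * (exp 1 * real k * real k ^ k)) *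
      ((exp 1 * real m * real m ^ m) * (exp 1 * real m * real m ^ m))"
    using m kp by (intro mult_mono exp_fact_le_power_self) simp_all
  also have "\<dots> = exp 1 ^ 5 * ?c * ?D"
    by (simp add: eval_nat_numeral algebra_simps)
  also have "\<dots> = exp 5 * ?c * ?D"
    by (simp flip: exp_of_nat_mult)
  finally have F: "exp (real r) * ?F \<le> exp 5 * ?c * ?D" .
  \<comment> \<open>Each of the five letter counts is at most \<open>r\<close>.\<close>
  have "?c \<le> real r * (real r * real r) * (real r * real r)"
    unfolding r by (intro mult_mono) simp_all
  then have c: "?c \<le> real r ^ 5"
    by (simp add: eval_nat_numeral mult_ac)
  have "(?\<Lambda> * ?d) ^ r * (exp (real r) * ?F) \<le> (?\<Lambda> * ?d) ^ r * (exp 5 * ?c * ?D)"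
    using X0 by (intro mult_left_mono F) simp
  also have "\<dots> = exp 5 * ?c * ((?\<Lambda> * ?d) ^ r * ?D)"
    by (simp only: mult_ac)
  also have "\<dots> \<le> exp 5 * real r ^ 5 * (exp (real r) * fact r)"
    by (rule mult_mono[OF mult_left_mono[OF c] order_trans[OF main' power_self_le_exp_fact]],
        simp, simp, intro mult_nonneg_nonneg zero_le_power X0) simp_all
  finally have "exp (real r) * ((?\<Lambda> * ?d) ^ r * ?F) \<le> exp (real r) * (exp 5 * real r ^ 5 * fact r)"
    by (simp only: mult_ac)
  then have "(?\<Lambda> * ?d) ^ r * ?F \<le> exp 5 * real r ^ 5 * fact r"
    by (rule mult_left_le_imp_le) simp
  then have "(?\<Lambda> * ?d) ^ r \<le> exp 5 * real r ^ 5 * fact r / ?F"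
    by (simp add: pos_le_divide_eq)
  then show ?thesis
    unfolding card_block_permutations[OF m kp] r[symmetric] by simp
qed

lemma block_growth:
  assumes X: "0 < X" "X < 2 + 2 * sqrt 2"
  obtains m k where "0 < m" "m \<le> k" "k \<le> 2 * m"
    "X ^ (4 * m + 2 * k) \<le> real (card (permutations_of_multiset (block_mset m k)))"
proof -
  let ?\<Lambda> = "2 + 2 * sqrt 2 :: real"
  \<comment> \<open>The gap between \<open>X\<close> and \<open>Y\<close> absorbs the polynomial
    factor, the gap between \<open>Y\<close> and \<open>?\<Lambda>\<close> the rounding
    error.\<close>
  obtain Y where Y: "X < Y" "Y < ?\<Lambda>"
    using dense X(2) by blast
  define q where "q = Y / X"
  have q: "1 < q" using X Y by (simp add: q_def)
  have "eventually (\<lambda>n. exp 5 * real n ^ 5 \<le> q ^ n) sequentially"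
    using q by real_asymp
  then obtain n0 where n0: "\<And>n. n0 \<le> n \<Longrightarrow> exp 5 * real n ^ 5 \<le> q ^ n"
    by (auto simp: eventually_sequentially)
  have "(\<lambda>m. 1 / (sqrt 2 * real m)) \<longlonglongrightarrow> 0"
    by real_asymp
  from tendsto_mult_left[OF tendsto_diff[OF tendsto_const this], of ?\<Lambda> 1]
  have "(\<lambda>m. ?\<Lambda> * (1 - 1 / (sqrt 2 * real m))) \<longlonglongrightarrow> ?\<Lambda>"
    by simp
  then have "eventually (\<lambda>m. Y < ?\<Lambda> * (1 - 1 / (sqrt 2 * real m))) sequentially"
    using Y(2) by (rule order_tendstoD)
  then obtain m0 where m0: "\<And>m. m0 \<le> m \<Longrightarrow> Y < ?\<Lambda> * (1 - 1 / (sqrt 2 * real m))"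
    by (auto simp: eventually_sequentially)
  \<comment> \<open>Since \<open>m\<close> passes both thresholds and \<open>r\<close> exceeds
    \<open>m\<close>, both estimates are available.\<close>
  define m where "m = Suc (max n0 m0)"
  define k where "k = nat \<lfloor>sqrt 2 * real m\<rfloor>"
  define r where "r = 4 * m + 2 * k"
  have m: "0 < m" "n0 \<le> r" "m0 \<le> m"
    by (auto simp: m_def r_def)
  have "1 * real m \<le> sqrt 2 * real m" "sqrt 2 * real m \<le> 2 * real m"
    using real_sqrt_le_mono[of 2 4] by (intro mult_right_mono; simp)+
  then have "m \<le> k" "k \<le> 2 * m"
    unfolding k_def by linarith+
  moreover have "X ^ r \<le> real (card (permutations_of_multiset (block_mset m k)))"
  proof -
    have "exp 5 * real r ^ 5 * X ^ r \<le> q ^ r * X ^ r"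
      using n0[OF m(2)] X by (intro mult_right_mono) simp_all
    also have "\<dots> = Y ^ r"
      using X by (simp add: q_def power_divide)
    also have "\<dots> \<le> (?\<Lambda> * (1 - 1 / (sqrt 2 * real m))) ^ r"
      using m0[OF m(3)] X Y by (intro power_mono) simp_all
    also have "\<dots> \<le> exp 5 * real r ^ 5 * real (card (permutations_of_multiset (block_mset m k)))"
      by (rule card_block_permutations_ge[OF m(1) k_def r_def])
    finally show ?thesis
      by (rule mult_left_le_imp_le) (use m(1) in \<open>simp add: r_def\<close>)
  qed
  ultimately show thesis
    using that m(1) unfolding r_def by blast
qed

section \<open>The limit of the roots\<close>

lemma root_tendsto_of_bounds:
  fixes c :: "nat \<Rightarrow> real"
  assumes up: "\<And>n. c n \<le> C * L ^ n" and C: "0 < C" and L: "1 < L"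
    and low: "\<And>X. 1 < X \<Longrightarrow> X < L \<Longrightarrow> \<exists>D>0. eventually (\<lambda>n. X ^ n \<le> D * c n) sequentially"
  shows "(\<lambda>n. root n (c n)) \<longlonglongrightarrow> L"
proof (rule order_tendstoI)
  fix a assume "L < a"
  \<comment> \<open>Constant factors disappear under the root. The index 0 is excluded below, since
    \<open>root 0\<close> is 0.\<close>
  have "(\<lambda>n. root n C * L) \<longlonglongrightarrow> 1 * L"
    using C by (intro tendsto_intros LIMSEQ_root_const)
  then have "eventually (\<lambda>n. root n C * L < a) sequentially"
    using \<open>L < a\<close> by (intro order_tendstoD) simp_all
  then show "eventually (\<lambda>n. root n (c n) < a) sequentially"
    using eventually_gt_at_top[of 0]
  proof eventually_elim
    case (elim n)
    have "root n (c n) \<le> root n (C * L ^ n)"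
      using elim up by simp
    also have "\<dots> = root n C * L"
      using elim L by (simp add: real_root_mult real_root_power_cancel)
    finally show ?case using elim by simp
  qed
next
  fix a assume "a < L"
  then have "max 1 a < L" using L by simp
  then obtain X where X: "max 1 a < X" "X < L"
    using dense by blast
  then have aX: "a < X" by simp
  obtain D where D: "0 < D" "eventually (\<lambda>n. X ^ n \<le> D * c n) sequentially"
    using low[of X] X by auto
  have "(\<lambda>n. root n (1 / D) * X) \<longlonglongrightarrow> 1 * X"
    using D by (intro tendsto_intros LIMSEQ_root_const) simp
  then have "eventually (\<lambda>n. a < root n (1 / D) * X) sequentially"
    by (rule order_tendstoD) (use aX in simp)
  then show "eventually (\<lambda>n. a < root n (c n)) sequentially"
    using eventually_gt_at_top[of 0] D(2)
  proof eventually_elim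
    case (elim n)
    have "root n (1 / D) * X = root n (1 / D * X ^ n)"
      using elim X by (simp only: real_root_mult) (simp add: real_root_power_cancel)
    also have "\<dots> \<le> root n (c n)"
      using elim D(1) by (simp add: field_simps)
    finally show ?case using elim by simp
  qed
qed

theorem theorem1:
  "(\<lambda>n. root n (real (mat2_pair.graded_codim
       (L_comp :: 2 \<Rightarrow> ('a::field_char_0 mat2 \<times> 'a mat2) set) n)))
     \<longlonglongrightarrow> 2 + 2 * sqrt 2"
proof (rule root_tendsto_of_bounds)
  let ?c = "mat2_pair.graded_codim (L_comp :: 2 \<Rightarrow> ('a mat2 \<times> 'a mat2) set)"
  show "real (?c n) \<le> sqrt 2 * (2 + 2 * sqrt 2) ^ n" for n
    using card_codim_words_le[of n] graded_codim_le[where 'a = 'a, of n] by linarith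
  show "0 < sqrt 2" "1 < 2 + 2 * sqrt 2" by (simp_all add: add_pos_nonneg)
  \<comment> \<open>For a fixed \<open>X\<close> a single block shape suffices; only the number of
    blocks grows with \<open>n\<close>.\<close>
  fix X :: real assume X: "1 < X" "X < 2 + 2 * sqrt 2"
  then obtain m k where mk: "0 < m" "m \<le> k" "k \<le> 2 * m"
    and K: "X ^ (4 * m + 2 * k) \<le> real (card (permutations_of_multiset (block_mset m k)))"
    using block_growth[of X] by auto
  define r where "r = 4 * m + 2 * k"
  have "X ^ n \<le> X ^ (9 * r + 1) * real (?c n)" if n: "8 * r + 1 \<le> n" for n
  proof -
    from n obtain M where M: "n = Suc M" "8 * r \<le> M"
      by (cases n) auto
    have "r * (M div r) + M mod r = M" "M mod r < r"
      using mk(1) by (simp_all add: r_def)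
    \<comment> \<open>The padding takes \<open>8 * r\<close> letters and the remainder is below
      \<open>r\<close>; the innermost variable adds the 1 in \<open>9 * r + 1\<close>.\<close>
    then have "M \<le> 9 * r + r * (M div r - 8)"
      unfolding diff_mult_distrib2 by linarith
    then have "X ^ n \<le> X ^ (9 * r + 1 + r * (M div r - 8))"
      using X M(1) by (intro power_increasing) simp_all
    also have "\<dots> = X ^ (9 * r + 1) * (X ^ r) ^ (M div r - 8)"
      by (simp only: power_add power_mult)
    also have "(X ^ r) ^ (M div r - 8) \<le> real (card (permutations_of_multiset (block_mset m k))) ^ (M div r - 8)"
      using K X unfolding r_def by (intro power_mono) simp_all
    also have "\<dots> \<le> real (card (ballot_words M))"
      using card_ballot_words_ge[OF mk(2,3) r_def M(2) mk(1)] by (simp flip: of_nat_power)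
    also have "\<dots> \<le> real (?c n)"
      unfolding M(1) by (simp add: graded_codim_ge)
    finally show ?thesis
      using X by simp
  qed
  then show "\<exists>D>0. eventually (\<lambda>n. X ^ n \<le> D * real (?c n)) sequentially"
    using X by (intro exI[of _ "X ^ (9 * r + 1)"] conjI eventually_sequentiallyI[of "8 * r + 1"]) auto
qed

end
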